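(* Let $(M,g)$ be a closed oriented Riemannian 3-manifold, let $T$ be a unit geodesic vector field on $M$ (i.e. $\nabla_T T=0$), and let $\mathcal D$ be the plane field orthogonal to $T$. Then the pair $(\mathcal D,T)$ is critical for the functional $\mathrm{gv}$ and $\mathrm{gv}(\mathcal D,T)=0$. In particular, for every two-dimensional transversely oriented Riemannian foliation $\mathcal F$ of $M$ (with $g$ a bundle-like metric and $T$ the unit normal field), the pair $(T\mathcal F,T)$ is a critical point of $\mathrm{gv}$ varying over all plane fields.
   Context: For a plane field $\mathcal D$ and a vector field $T$ transverse to it, let $\omega$ be the unique 1-form with $\ker\omega=\mathcal D$, $\omega(T)=1$, and put $\eta=\iota_T\,d\omega$ and $\mathrm{gv}(\mathcal D,T)=\int_M\eta\wedge d\eta$. Variations of $(\mathcal D,T)$ are smooth families $(\omega_t,T_t)$, $|t|<\varepsilon$, of 1-forms and vector fields with $\omega_t(T_t)\equiv1$, $(\omega_0,T_0)=(\omega,T)$, and $\mathcal D_t=\ker\omega_t$. The pair $(\mathcal D,T)$ is critical if $\frac{d}{dt}\mathrm{gv}(\mathcal D_t,T_t)|_{t=0}=0$ for every variation. $\nabla$ is the Levi-Civita connection of $g$. *)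

theory Defs
  imports "HOL-Analysis.Analysis"
begin

section \<open>Smooth maps between Euclidean spaces\<close>

primrec Ck_on :: "nat \<Rightarrow> 'a::real_normed_vector set \<Rightarrow> ('a \<Rightarrow> 'b::real_normed_vector) \<Rightarrow> bool" where
  "Ck_on 0 S f \<longleftrightarrow> continuous_on S f"
| "Ck_on (Suc k) S f \<longleftrightarrow> (\<forall>x\<in>S. f differentiable (at x)) \<and>
     (\<forall>v. Ck_on k S (\<lambda>x. frechet_derivative f (at x) v))"

text \<open>Only used for open \<open>S\<close>.\<close>

definition smooth_on :: "'a::real_normed_vector set \<Rightarrow> ('a \<Rightarrow> 'b::real_normed_vector) \<Rightarrow> bool" where
  "smooth_on S f \<longleftrightarrow> (\<forall>k. Ck_on k S f)"


section \<open>Smooth manifolds\<close>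

text \<open>A chart is a pair \<open>(U, \<phi>)\<close>; the values of \<open>\<phi>\<close> outside \<open>U\<close> are irrelevant.\<close>

type_synonym ('a, 'n) chart = "'a set \<times> ('a \<Rightarrow> real ^ 'n)"

abbreviation cdom :: "('a, 'n::finite) chart \<Rightarrow> 'a set" where
  "cdom c \<equiv> fst c"

abbreviation cmap :: "('a, 'n::finite) chart \<Rightarrow> 'a \<Rightarrow> real ^ 'n" where
  "cmap c \<equiv> snd c"

definition cimg :: "('a, 'n::finite) chart \<Rightarrow> (real ^ 'n) set" where
  "cimg c = cmap c ` cdom c"

definition cinv :: "('a, 'n::finite) chart \<Rightarrow> real ^ 'n \<Rightarrow> 'a" where
  "cinv c = inv_into (cdom c) (cmap c)"

definition is_chart :: "'a topology \<Rightarrow> ('a, 'n::finite) chart \<Rightarrow> bool" where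
  "is_chart X c \<longleftrightarrow> openin X (cdom c) \<and> open (cimg c) \<and>
     homeomorphic_map (subtopology X (cdom c)) (top_of_set (cimg c)) (cmap c)"

definition overlap :: "('a, 'n::finite) chart \<Rightarrow> ('a, 'n) chart \<Rightarrow> (real ^ 'n) set" where
  "overlap c d = cmap c ` (cdom c \<inter> cdom d)"

definition transition :: "('a, 'n::finite) chart \<Rightarrow> ('a, 'n) chart \<Rightarrow> real ^ 'n \<Rightarrow> real ^ 'n" where
  "transition c d = cmap d \<circ> cinv c"

definition jac :: "('a, 'n::finite) chart \<Rightarrow> ('a, 'n) chart \<Rightarrow> real ^ 'n \<Rightarrow> real ^ 'n \<Rightarrow> real ^ 'n" where
  "jac c d x = frechet_derivative (transition c d) (at x)"

definition compatible :: "('a, 'n::finite) chart \<Rightarrow> ('a, 'n) chart \<Rightarrow> bool" where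
  "compatible c d \<longleftrightarrow> smooth_on (overlap c d) (transition c d) \<and>
     smooth_on (overlap d c) (transition d c)"

definition smooth_manifold :: "'a topology \<Rightarrow> ('a, 'n::finite) chart set \<Rightarrow> bool" where
  "smooth_manifold X A \<longleftrightarrow> Hausdorff_space X \<and> second_countable X \<and>
     (\<forall>c\<in>A. is_chart X c) \<and> (\<Union>c\<in>A. cdom c) = topspace X \<and>
     (\<forall>c\<in>A. \<forall>d\<in>A. compatible c d) \<and>
     (\<forall>c. is_chart X c \<and> (\<forall>d\<in>A. compatible c d) \<longrightarrow> c \<in> A)"

text \<open>An orientation is represented by an oriented atlas contained in the maximal atlas.\<close>

definition orientation :: "'a topology \<Rightarrow> ('a, 'n::finite) chart set \<Rightarrow> ('a, 'n) chart set \<Rightarrow> bool" where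
  "orientation X A Or \<longleftrightarrow> Or \<subseteq> A \<and> (\<Union>c\<in>Or. cdom c) = topspace X \<and>
     (\<forall>c\<in>Or. \<forall>d\<in>Or. \<forall>x\<in>overlap c d. det (matrix (jac c d x)) > 0)"

definition closed_oriented_manifold ::
    "'a topology \<Rightarrow> ('a, 'n::finite) chart set \<Rightarrow> ('a, 'n) chart set \<Rightarrow> bool" where
  "closed_oriented_manifold X A Or \<longleftrightarrow>
     smooth_manifold X A \<and> compact_space X \<and> orientation X A Or"

definition smooth_fun :: "('a, 'n::finite) chart set \<Rightarrow> ('a \<Rightarrow> real) \<Rightarrow> bool" where
  "smooth_fun A f \<longleftrightarrow> (\<forall>c\<in>A. smooth_on (cimg c) (f \<circ> cinv c))"


section \<open>Tensor fields in local coordinates\<close>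

text \<open>A tensor field is the family of its coordinate expressions in the charts \<open>c\<close> of the
  atlas, each a function on \<open>cimg c\<close>, subject to the usual transformation law. Values at points
  outside \<open>cimg c\<close> carry no meaning. In each chart, tangent vectors at a point are identified with
  elements of \<open>real ^ 'n\<close>, and \<open>k\<close>-forms are evaluated on \<open>k\<close> tangent vectors.\<close>

type_synonym ('a, 'n) vfield = "('a, 'n) chart \<Rightarrow> real ^ 'n \<Rightarrow> real ^ 'n"
type_synonym ('a, 'n) dfield = "('a, 'n) chart \<Rightarrow> real ^ 'n \<Rightarrow> (real ^ 'n) set"
type_synonym ('a, 'n) form1 = "('a, 'n) chart \<Rightarrow> real ^ 'n \<Rightarrow> real ^ 'n \<Rightarrow> real"
type_synonym ('a, 'n) form2 = "('a, 'n) chart \<Rightarrow> real ^ 'n \<Rightarrow> real ^ 'n \<Rightarrow> real ^ 'n \<Rightarrow> real"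
type_synonym ('a, 'n) form3 =
  "('a, 'n) chart \<Rightarrow> real ^ 'n \<Rightarrow> real ^ 'n \<Rightarrow> real ^ 'n \<Rightarrow> real ^ 'n \<Rightarrow> real"

definition vector_field :: "('a, 'n::finite) chart set \<Rightarrow> ('a, 'n) vfield \<Rightarrow> bool" where
  "vector_field A V \<longleftrightarrow> (\<forall>c\<in>A. smooth_on (cimg c) (V c)) \<and>
     (\<forall>c\<in>A. \<forall>d\<in>A. \<forall>x\<in>overlap c d. V d (transition c d x) = jac c d x (V c x))"

definition vf_eq :: "('a, 'n::finite) chart set \<Rightarrow> ('a, 'n) vfield \<Rightarrow> ('a, 'n) vfield \<Rightarrow> bool" where
  "vf_eq A V W \<longleftrightarrow> (\<forall>c\<in>A. \<forall>x\<in>cimg c. V c x = W c x)"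

definition one_form :: "('a, 'n::finite) chart set \<Rightarrow> ('a, 'n) form1 \<Rightarrow> bool" where
  "one_form A \<omega> \<longleftrightarrow>
     (\<forall>c\<in>A. (\<forall>x\<in>cimg c. linear (\<omega> c x)) \<and> (\<forall>v. smooth_on (cimg c) (\<lambda>x. \<omega> c x v))) \<and>
     (\<forall>c\<in>A. \<forall>d\<in>A. \<forall>x\<in>overlap c d. \<forall>v. \<omega> c x v = \<omega> d (transition c d x) (jac c d x v))"

definition ext_deriv :: "('a, 'n::finite) form1 \<Rightarrow> ('a, 'n) form2" where
  "ext_deriv \<omega> c x u v =
     frechet_derivative (\<lambda>y. \<omega> c y v) (at x) u - frechet_derivative (\<lambda>y. \<omega> c y u) (at x) v"

definition contract :: "('a, 'n::finite) vfield \<Rightarrow> ('a, 'n) form2 \<Rightarrow> ('a, 'n) form1" where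
  "contract T \<beta> c x v = \<beta> c x (T c x) v"

definition wedge12 :: "('a, 'n::finite) form1 \<Rightarrow> ('a, 'n) form2 \<Rightarrow> ('a, 'n) form3" where
  "wedge12 \<alpha> \<beta> c x u v w =
     \<alpha> c x u * \<beta> c x v w - \<alpha> c x v * \<beta> c x u w + \<alpha> c x w * \<beta> c x u v"


section \<open>Integration of 3-forms on closed oriented 3-manifolds\<close>

text \<open>Finite partitions of unity subordinate to the domains of oriented charts.\<close>

definition partition_of_unity ::
    "'a topology \<Rightarrow> ('a, 'n::finite) chart set \<Rightarrow> ('a, 'n) chart set \<Rightarrow>
     ('a, 'n) chart set \<Rightarrow> (('a, 'n) chart \<Rightarrow> 'a \<Rightarrow> real) \<Rightarrow> bool" where
  "partition_of_unity X A Or C \<rho> \<longleftrightarrow> finite C \<and> C \<subseteq> Or \<and>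
     (\<forall>c\<in>C. smooth_fun A (\<rho> c) \<and> (\<forall>p\<in>topspace X. 0 \<le> \<rho> c p) \<and>
        X closure_of {p \<in> topspace X. \<rho> c p \<noteq> 0} \<subseteq> cdom c) \<and>
     (\<forall>p\<in>topspace X. (\<Sum>c\<in>C. \<rho> c p) = 1)"

text \<open>The integral is computed with one chosen partition of unity, depending on \<open>X\<close>, \<open>A\<close>, \<open>Or\<close>
  only. By the change of variables formula its value is the same for every such partition, and
  depends on \<open>Or\<close> only through the orientation.\<close>

definition form_integral ::
    "'a topology \<Rightarrow> ('a, 3) chart set \<Rightarrow> ('a, 3) chart set \<Rightarrow> ('a, 3) form3 \<Rightarrow> real" where
  "form_integral X A Or \<theta> =
     (let (C, \<rho>) = (SOME (C, \<rho>). partition_of_unity X A Or C \<rho>) in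
      \<Sum>c\<in>C. integral (cimg c)
        (\<lambda>x. \<rho> c (cinv c x) * \<theta> c x (axis 1 1) (axis 2 1) (axis 3 1)))"


section \<open>The functional gv and its critical points\<close>

definition kernel_field :: "('a, 'n::finite) form1 \<Rightarrow> ('a, 'n) dfield" where
  "kernel_field \<omega> c x = {v. \<omega> c x v = 0}"

definition defining_form :: "('a, 'n::finite) dfield \<Rightarrow> ('a, 'n) vfield \<Rightarrow> ('a, 'n) form1" where
  "defining_form D T c x = (THE l. linear l \<and> {v. l v = 0} = D c x \<and> l (T c x) = 1)"

lemma defining_form_eqI:
  fixes D :: "('a, 'n::finite) dfield"
  assumes "linear l" "{v. l v = 0} = D c x" "l (T c x) = 1"
  shows "defining_form D T c x = l"
  unfolding defining_form_def
proof (rule the_equality)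
  show "linear l \<and> {v. l v = 0} = D c x \<and> l (T c x) = 1"
    using assms by blast
next
  fix m :: "real ^ 'n \<Rightarrow> real" assume m: "linear m \<and> {v. m v = 0} = D c x \<and> m (T c x) = 1"
  show "m = l"
  proof
    fix v
    have "l (v - l v *\<^sub>R T c x) = 0"
      using assms by (simp add: linear_diff linear_scale)
    then have "m (v - l v *\<^sub>R T c x) = 0"
      using assms(2) m by blast
    then show "m v = l v"
      using m by (simp add: linear_diff linear_scale)
  qed
qed

definition gv ::
    "'a topology \<Rightarrow> ('a, 3) chart set \<Rightarrow> ('a, 3) chart set \<Rightarrow>
     ('a, 3) dfield \<Rightarrow> ('a, 3) vfield \<Rightarrow> real" where
  "gv X A Or D T =
     (let \<eta> = contract T (ext_deriv (defining_form D T))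
      in form_integral X A Or (wedge12 \<eta> (ext_deriv \<eta>)))"

definition variation ::
    "('a, 'n::finite) chart set \<Rightarrow> ('a, 'n) dfield \<Rightarrow> ('a, 'n) vfield \<Rightarrow> real \<Rightarrow>
     (real \<Rightarrow> ('a, 'n) form1) \<Rightarrow> (real \<Rightarrow> ('a, 'n) vfield) \<Rightarrow> bool" where
  "variation A D T \<epsilon> \<omega> V \<longleftrightarrow>
     (\<forall>t. \<bar>t\<bar> < \<epsilon> \<longrightarrow> one_form A (\<omega> t) \<and> vector_field A (V t) \<and>
        (\<forall>c\<in>A. \<forall>x\<in>cimg c. \<omega> t c x (V t c x) = 1)) \<and>
     (\<forall>c\<in>A. (\<forall>v. smooth_on ({-\<epsilon><..<\<epsilon>} \<times> cimg c) (\<lambda>(t, x). \<omega> t c x v)) \<and>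
        smooth_on ({-\<epsilon><..<\<epsilon>} \<times> cimg c) (\<lambda>(t, x). V t c x)) \<and>
     (\<forall>c\<in>A. \<forall>x\<in>cimg c. \<omega> 0 c x = defining_form D T c x \<and> V 0 c x = T c x)"

definition critical ::
    "'a topology \<Rightarrow> ('a, 3) chart set \<Rightarrow> ('a, 3) chart set \<Rightarrow>
     ('a, 3) dfield \<Rightarrow> ('a, 3) vfield \<Rightarrow> bool" where
  "critical X A Or D T \<longleftrightarrow>
     (\<forall>\<epsilon>>0. \<forall>\<omega> V. variation A D T \<epsilon> \<omega> V \<longrightarrow>
        ((\<lambda>t. gv X A Or (kernel_field (\<omega> t)) (V t)) has_real_derivative 0) (at 0))"


section \<open>Riemannian metrics and the Levi-Civita connection\<close>

definition riemannian_metric :: "('a, 'n::finite) chart set \<Rightarrow> ('a, 'n) form2 \<Rightarrow> bool" where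
  "riemannian_metric A g \<longleftrightarrow>
     (\<forall>c\<in>A. \<forall>x\<in>cimg c. (\<forall>u. linear (g c x u)) \<and> (\<forall>u v. g c x u v = g c x v u) \<and>
        (\<forall>v. v \<noteq> 0 \<longrightarrow> g c x v v > 0)) \<and>
     (\<forall>c\<in>A. \<forall>u v. smooth_on (cimg c) (\<lambda>x. g c x u v)) \<and>
     (\<forall>c\<in>A. \<forall>d\<in>A. \<forall>x\<in>overlap c d. \<forall>u v.
        g c x u v = g d (transition c d x) (jac c d x u) (jac c d x v))"

definition lie_bracket :: "('a, 'n::finite) vfield \<Rightarrow> ('a, 'n) vfield \<Rightarrow> ('a, 'n) vfield" where
  "lie_bracket V W c x =
     frechet_derivative (W c) (at x) (V c x) - frechet_derivative (V c) (at x) (W c x)"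

definition affine_connection ::
    "('a, 'n::finite) chart set \<Rightarrow> (('a, 'n) vfield \<Rightarrow> ('a, 'n) vfield \<Rightarrow> ('a, 'n) vfield) \<Rightarrow> bool" where
  "affine_connection A nabla \<longleftrightarrow>
     (\<forall>V W. vector_field A V \<and> vector_field A W \<longrightarrow>
        vector_field A (nabla V W) \<and>
        (\<forall>V'. vector_field A V' \<longrightarrow>
           vf_eq A (nabla (\<lambda>c x. V c x + V' c x) W) (\<lambda>c x. nabla V W c x + nabla V' W c x)) \<and>
        (\<forall>W'. vector_field A W' \<longrightarrow>
           vf_eq A (nabla V (\<lambda>c x. W c x + W' c x)) (\<lambda>c x. nabla V W c x + nabla V W' c x)) \<and>
        (\<forall>f. smooth_fun A f \<longrightarrow>
           vf_eq A (nabla (\<lambda>c x. f (cinv c x) *\<^sub>R V c x) W) (\<lambda>c x. f (cinv c x) *\<^sub>R nabla V W c x) \<and>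
           vf_eq A (nabla V (\<lambda>c x. f (cinv c x) *\<^sub>R W c x))
             (\<lambda>c x. frechet_derivative (f \<circ> cinv c) (at x) (V c x) *\<^sub>R W c x +
                    f (cinv c x) *\<^sub>R nabla V W c x)))"

text \<open>The torsion-free affine connection compatible with \<open>g\<close>; it is unique (as an operator on
  coordinate expressions restricted to the chart images).\<close>

definition levi_civita ::
    "('a, 'n::finite) chart set \<Rightarrow> ('a, 'n) form2 \<Rightarrow>
     (('a, 'n) vfield \<Rightarrow> ('a, 'n) vfield \<Rightarrow> ('a, 'n) vfield) \<Rightarrow> bool" where
  "levi_civita A g nabla \<longleftrightarrow> affine_connection A nabla \<and>
     (\<forall>V W. vector_field A V \<and> vector_field A W \<longrightarrow>
        vf_eq A (\<lambda>c x. nabla V W c x - nabla W V c x) (lie_bracket V W)) \<and>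
     (\<forall>U V W. vector_field A U \<and> vector_field A V \<and> vector_field A W \<longrightarrow>
        (\<forall>c\<in>A. \<forall>x\<in>cimg c.
           frechet_derivative (\<lambda>y. g c y (V c y) (W c y)) (at x) (U c x) =
             g c x (nabla U V c x) (W c x) + g c x (V c x) (nabla U W c x)))"

definition unit_field :: "('a, 'n::finite) chart set \<Rightarrow> ('a, 'n) form2 \<Rightarrow> ('a, 'n) vfield \<Rightarrow> bool" where
  "unit_field A g T \<longleftrightarrow> (\<forall>c\<in>A. \<forall>x\<in>cimg c. g c x (T c x) (T c x) = 1)"

definition orthogonal_field :: "('a, 'n::finite) form2 \<Rightarrow> ('a, 'n) vfield \<Rightarrow> ('a, 'n) dfield" where
  "orthogonal_field g T c x = {v. g c x v (T c x) = 0}"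


section \<open>Two-dimensional transversely oriented foliations\<close>

text \<open>A foliation is given by an atlas of foliated charts, in which the leaves are locally the
  level sets of the third coordinate: the changes of coordinates have locally the form
  \<open>(x, y) \<mapsto> (h\<^sub>1 (x, y), h\<^sub>2 y)\<close> with \<open>x\<close> in the plane and \<open>y\<close> real, and \<open>h\<^sub>2' > 0\<close> for the
  transverse orientation. The foliated charts need not be positively oriented for \<open>M\<close>.\<close>

definition transversely_oriented_foliation ::
    "'a topology \<Rightarrow> ('a, 3) chart set \<Rightarrow> ('a, 3) chart set \<Rightarrow> bool" where
  "transversely_oriented_foliation X A F \<longleftrightarrow> F \<subseteq> A \<and> (\<Union>f\<in>F. cdom f) = topspace X \<and>
     (\<forall>f\<in>F. \<forall>f'\<in>F. \<forall>x0\<in>overlap f f'.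
        (\<exists>N h. open N \<and> x0 \<in> N \<and> N \<subseteq> overlap f f' \<and>
           (\<forall>x\<in>N. transition f f' x $ 3 = h (x $ 3))) \<and>
        jac f f' x0 (axis 3 1) $ 3 > 0)"

definition tangent_field :: "('a, 3) chart set \<Rightarrow> ('a, 3) dfield" where
  "tangent_field F c x = {v. \<exists>f\<in>F. x \<in> overlap c f \<and> jac c f x v $ 3 = 0}"

definition unit_normal ::
    "('a, 3) chart set \<Rightarrow> ('a, 3) form2 \<Rightarrow> ('a, 3) chart set \<Rightarrow> ('a, 3) vfield \<Rightarrow> bool" where
  "unit_normal A g F T \<longleftrightarrow> vector_field A T \<and> unit_field A g T \<and>
     (\<forall>c\<in>A. \<forall>x\<in>cimg c. \<forall>v\<in>tangent_field F c x. g c x v (T c x) = 0) \<and>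
     (\<forall>f\<in>F. \<forall>x\<in>cimg f. T f x $ 3 > 0)"

text \<open>Reinhart's condition: in a foliated chart with transverse coordinate \<open>y\<close>, the metric
  restricted to vectors normal to the leaves is \<open>h(y) dy\<^sup>2\<close>, with \<open>h\<close> depending (locally) on
  \<open>y\<close> only.\<close>

definition bundle_like ::
    "('a, 3) form2 \<Rightarrow> ('a, 3) chart set \<Rightarrow> bool" where
  "bundle_like g F \<longleftrightarrow>
     (\<forall>f\<in>F. \<forall>x0\<in>cimg f. \<exists>N h. open N \<and> x0 \<in> N \<and> N \<subseteq> cimg f \<and>
        (\<forall>x\<in>N. \<forall>v. (\<forall>w. w $ 3 = 0 \<longrightarrow> g f x v w = 0) \<longrightarrow>
           g f x v v = h (x $ 3) * (v $ 3)\<^sup>2))"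

end

theory Submission
  imports Defs
begin

text \<open>
  Criticality and vanishing of \<open>gv\<close> both come from one pointwise fact: for the pairs in question
  the form \<open>\<eta> = \<iota>\<^sub>T d\<omega>\<close> is identically zero. Then \<open>gv\<close>, an integral of
  \<open>\<eta> \<and> d\<eta>\<close>, is zero. Along a variation, \<open>\<eta>\<^sub>t\<close> is smooth in \<open>t\<close> and in the point and vanishes
  at \<open>t = 0\<close>, and so does \<open>d\<eta>\<^sub>t\<close>; hence \<open>\<eta>\<^sub>t \<and> d\<eta>\<^sub>t\<close> is \<open>O(t\<^sup>2)\<close> uniformly on compact sets, its
  integral is \<open>O(t\<^sup>2)\<close>, and the derivative at \<open>0\<close> is zero
  (\<open>contract_zero_imp_critical\<close>, \<open>contract_zero_imp_gv_zero\<close>).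

  For a unit geodesic field, \<open>\<omega> = g(T, \<cdot>)\<close>. The Cartan formula and the axioms of the Levi-Civita
  connection give, for every vector field \<open>W\<close>,
  \<open>d\<omega>(T, W) = T g(T, W) - W g(T, T) - g(T, [T, W]) = g(\<nabla>\<^sub>T T, W) + g(T, \<nabla>\<^sub>W T)\<close>.
  The first summand is zero because \<open>T\<close> is geodesic, the second is half the derivative along \<open>W\<close>
  of \<open>g(T, T) = 1\<close> (\<open>geodesic_contract_zero\<close>). As \<open>W\<close> has to be a global field with a prescribed
  value at a point, this uses a bump function.

  For a Riemannian foliation, let \<open>y\<close> be the third coordinate of a foliated chart, so that
  \<open>\<omega> = dy / T\<^sub>3\<close>, where \<open>T\<^sub>3 = dy(T)\<close>. The metric being bundle-like, \<open>T\<^sub>3\<close> is locally a function of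
  \<open>y\<close> alone, hence \<open>d\<omega> = 0\<close> (\<open>foliation_ext_deriv_zero\<close>). In an arbitrary chart \<open>y\<close> is only a smooth
  function and \<open>ddy = 0\<close> is the symmetry of its second derivative.

  An integral over the manifold is computed with a chosen finite partition of unity, and its value is
  known only because such partitions exist (\<open>partition_of_unity_exists\<close>). This rests on the flat
  function \<open>exp (-1/s)\<close> and the stability of \<open>smooth_on\<close> under products, composition and gluing.
\<close>

section \<open>Calculus of smooth maps\<close>

lemma has_derivative_cong_open:
  assumes "open S" "x \<in> S" "\<And>y. y \<in> S \<Longrightarrow> f y = g y"
  shows "(f has_derivative D) (at x) \<longleftrightarrow> (g has_derivative D) (at x)"
  using has_derivative_transform_within_open[OF _ assms(1,2), of f D UNIV g]
    has_derivative_transform_within_open[OF _ assms(1,2), of g D UNIV f] assms(3) by metis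

lemma frechet_derivative_cong_open:
  assumes "open S" "x \<in> S" "\<And>y. y \<in> S \<Longrightarrow> f y = g y"
  shows "frechet_derivative f (at x) = frechet_derivative g (at x)"
  unfolding frechet_derivative_def using has_derivative_cong_open[OF assms] by simp

lemma Ck_on_cong:
  assumes "open S" "\<And>x. x \<in> S \<Longrightarrow> f x = g x"
  shows "Ck_on k S f = Ck_on k S g"
  using assms(2)
proof (induction k arbitrary: f g)
  case 0
  then show ?case by (simp cong: continuous_on_cong)
next
  case (Suc k)
  have "frechet_derivative f (at x) = frechet_derivative g (at x)" if "x \<in> S" for x
    by (rule frechet_derivative_cong_open[OF assms(1) that Suc.prems])
  moreover from this have "Ck_on k S (\<lambda>x. frechet_derivative f (at x) v) =
      Ck_on k S (\<lambda>x. frechet_derivative g (at x) v)" for v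
    by (intro Suc.IH) simp
  moreover have "f differentiable (at x) \<longleftrightarrow> g differentiable (at x)" if "x \<in> S" for x
    unfolding differentiable_def using has_derivative_cong_open[OF assms(1) that Suc.prems] by simp
  ultimately show ?case
    by simp
qed

lemma Ck_on_subset: "Ck_on k S f \<Longrightarrow> T \<subseteq> S \<Longrightarrow> Ck_on k T f"
  by (induction k arbitrary: f) (auto intro: continuous_on_subset)

text \<open>Lets \<open>C\<^sup>k\<^sup>+\<^sup>1\<close> be shown with an explicit formula for the derivative, which is needed only on the
  open set; this is how all closure properties below go through by induction on \<open>k\<close>.\<close>

lemma Ck_on_SucI:
  assumes "open S" "\<And>x. x \<in> S \<Longrightarrow> (f has_derivative f' x) (at x)" "\<And>v. Ck_on k S (\<lambda>x. f' x v)"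
  shows "Ck_on (Suc k) S f"
proof -
  have "frechet_derivative f (at x) = f' x" if "x \<in> S" for x
    using assms(2)[OF that] frechet_derivative_at by metis
  then have "Ck_on k S (\<lambda>x. frechet_derivative f (at x) v)" for v
    using assms(3)[of v] Ck_on_cong[OF assms(1), of "\<lambda>x. frechet_derivative f (at x) v"] by simp
  then show ?thesis
    using assms(2) by (auto simp: differentiable_def)
qed

lemma Ck_on_has_derivative:
  "Ck_on (Suc k) S f \<Longrightarrow> x \<in> S \<Longrightarrow> (f has_derivative frechet_derivative f (at x)) (at x)"
  using frechet_derivative_works by auto

lemma Ck_on_SucD: "Ck_on (Suc k) S f \<Longrightarrow> Ck_on k S f"
proof (induction k arbitrary: f)
  case 0
  then have "f differentiable_on S"
    by (auto simp: differentiable_on_def intro: differentiable_at_withinI)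
  then show ?case by (simp add: differentiable_imp_continuous_on)
next
  case (Suc k)
  have "Ck_on k S (\<lambda>x. frechet_derivative f (at x) v)" for v
    by (rule Suc.IH) (use Suc.prems in simp)
  with Suc.prems show ?case
    by simp
qed

lemma Ck_on_const: "open S \<Longrightarrow> Ck_on k S (\<lambda>x. c)"
proof (induction k arbitrary: c)
  case (Suc k)
  show ?case by (rule Ck_on_SucI[where f' = "\<lambda>x v. 0"]) (use Suc in auto)
qed simp

lemma Ck_on_linear: "open S \<Longrightarrow> bounded_linear L \<Longrightarrow> Ck_on k S L"
proof (cases k)
  case (Suc n)
  assume "open S" "bounded_linear L"
  then show ?thesis
    unfolding Suc
    by (intro Ck_on_SucI[where f' = "\<lambda>x. L"]) (auto intro: bounded_linear_imp_has_derivative Ck_on_const)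
qed (simp add: linear_continuous_on)

lemma Ck_on_add:
  "open S \<Longrightarrow> Ck_on k S f \<Longrightarrow> Ck_on k S g \<Longrightarrow> Ck_on k S (\<lambda>x. f x + g x)"
proof (induction k arbitrary: f g)
  case (Suc k)
  show ?case
    by (rule Ck_on_SucI[where f' = "\<lambda>x v. frechet_derivative f (at x) v + frechet_derivative g (at x) v"])
      (use Suc in \<open>auto intro!: has_derivative_add simp: frechet_derivative_works\<close>)
qed (simp add: continuous_on_add)

lemma Ck_on_sum:
  assumes "open S" "\<And>i. i \<in> I \<Longrightarrow> Ck_on k S (f i)"
  shows "Ck_on k S (\<lambda>x. \<Sum>i\<in>I. f i x)"
  using assms(2)
  by (induction I rule: infinite_finite_induct) (auto intro: Ck_on_const Ck_on_add assms(1))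

lemma Ck_on_bilinear:
  assumes "bounded_bilinear B" "open S"
  shows "Ck_on k S f \<Longrightarrow> Ck_on k S g \<Longrightarrow> Ck_on k S (\<lambda>x. B (f x) (g x))"
proof (induction k arbitrary: f g)
  case 0
  then show ?case using bounded_bilinear.continuous_on[OF assms(1)] by simp
next
  case (Suc k)
  show ?case
  proof (rule Ck_on_SucI[OF assms(2)])
    fix x assume "x \<in> S"
    show "((\<lambda>x. B (f x) (g x)) has_derivative
      (\<lambda>v. B (f x) (frechet_derivative g (at x) v) + B (frechet_derivative f (at x) v) (g x))) (at x)"
      using Suc.prems \<open>x \<in> S\<close> by (intro bounded_bilinear.FDERIV[OF assms(1)] Ck_on_has_derivative)
  next
    fix v
    show "Ck_on k S (\<lambda>x. B (f x) (frechet_derivative g (at x) v) + B (frechet_derivative f (at x) v) (g x))"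
      using Suc.prems Ck_on_SucD[OF Suc.prems(1)] Ck_on_SucD[OF Suc.prems(2)]
      by (intro Ck_on_add assms(2) Suc.IH) simp_all
  qed
qed

text \<open>By the chain rule the derivative of \<open>f \<circ> g\<close> in direction \<open>v\<close> is the sum over the basis vectors
  \<open>b\<close> of \<open>(\<partial>\<^sub>v g \<bullet> b) (\<partial>\<^sub>b f) \<circ> g\<close>, so the induction hypothesis is applied to the partial derivatives
  of \<open>f\<close>. Fixing basis directions is what turns the varying direction \<open>\<partial>\<^sub>v g\<close> into coefficients.\<close>

lemma Ck_on_compose:
  fixes f :: "'b::euclidean_space \<Rightarrow> 'c::real_normed_vector" and g :: "'a::real_normed_vector \<Rightarrow> 'b"
  assumes "open S"
  shows "Ck_on k T f \<Longrightarrow> Ck_on k S g \<Longrightarrow> g ` S \<subseteq> T \<Longrightarrow> Ck_on k S (\<lambda>x. f (g x))"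
proof (induction k arbitrary: f)
  case 0
  then show ?case
    using continuous_on_compose2[of T f S g] by simp
next
  case (Suc k)
  let ?Df = "\<lambda>y. frechet_derivative f (at y)" and ?Dg = "\<lambda>y. frechet_derivative g (at y)"
  have gk: "Ck_on k S g" using Suc.prems(2) by (rule Ck_on_SucD)
  show ?case
  proof (rule Ck_on_SucI[OF assms])
    fix x assume x: "x \<in> S"
    have dg: "(g has_derivative ?Dg x) (at x)" using Suc.prems x by (intro Ck_on_has_derivative)
    have df: "(f has_derivative ?Df (g x)) (at (g x))" using Suc.prems x by (intro Ck_on_has_derivative) auto
    have "?Df (g x) w = (\<Sum>b\<in>Basis. (w \<bullet> b) *\<^sub>R ?Df (g x) b)" for w
    proof -
      have l: "linear (?Df (g x))" using df by (simp add: has_derivative_linear)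
      have "?Df (g x) (\<Sum>b\<in>Basis. (w \<bullet> b) *\<^sub>R b) = (\<Sum>b\<in>Basis. (w \<bullet> b) *\<^sub>R ?Df (g x) b)"
        by (simp add: linear_sum[OF l] linear_scale[OF l])
      then show ?thesis by (simp add: euclidean_representation)
    qed
    then have eq: "(\<lambda>v. ?Df (g x) (?Dg x v)) = (\<lambda>v. \<Sum>b\<in>Basis. (?Dg x v \<bullet> b) *\<^sub>R ?Df (g x) b)"
      by blast
    show "((\<lambda>x. f (g x)) has_derivative (\<lambda>v. \<Sum>b\<in>Basis. (?Dg x v \<bullet> b) *\<^sub>R ?Df (g x) b)) (at x)"
      using has_derivative_compose[OF dg df] unfolding eq .
  next
    fix v
    have *: "Ck_on k S (\<lambda>x. ?Df (g x) b)" for b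
      by (rule Suc.IH[OF _ gk Suc.prems(3)]) (use Suc.prems(1) in simp)
    have **: "Ck_on k S (\<lambda>x. ?Dg x v \<bullet> b)" for b :: 'b
      by (rule Ck_on_bilinear[OF bounded_bilinear_inner assms _ Ck_on_const[OF assms]]) (use Suc.prems(2) in simp)
    show "Ck_on k S (\<lambda>x. \<Sum>b\<in>Basis. (?Dg x v \<bullet> b) *\<^sub>R ?Df (g x) b)"
      by (intro Ck_on_sum assms Ck_on_bilinear[OF bounded_bilinear_scaleR] * **)
  qed
qed

lemma Ck_on_Un:
  assumes "open S" "open T"
  shows "Ck_on k S f \<Longrightarrow> Ck_on k T f \<Longrightarrow> Ck_on k (S \<union> T) f"
  by (induction k arbitrary: f) (auto intro: continuous_on_open_Un assms)

lemma smooth_on_cong: "open S \<Longrightarrow> (\<And>x. x \<in> S \<Longrightarrow> f x = g x) \<Longrightarrow> smooth_on S f = smooth_on S g"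
  unfolding smooth_on_def using Ck_on_cong by blast

lemma smooth_on_subset: "smooth_on S f \<Longrightarrow> T \<subseteq> S \<Longrightarrow> smooth_on T f"
  unfolding smooth_on_def using Ck_on_subset by blast

lemma smooth_on_const: "open S \<Longrightarrow> smooth_on S (\<lambda>x. c)"
  by (simp add: smooth_on_def Ck_on_const)

lemma smooth_on_linear: "open S \<Longrightarrow> bounded_linear L \<Longrightarrow> smooth_on S L"
  by (simp add: smooth_on_def Ck_on_linear)

lemma smooth_on_add: "open S \<Longrightarrow> smooth_on S f \<Longrightarrow> smooth_on S g \<Longrightarrow> smooth_on S (\<lambda>x. f x + g x)"
  by (simp add: smooth_on_def Ck_on_add)

lemma smooth_on_sum: "open S \<Longrightarrow> (\<And>i. i \<in> I \<Longrightarrow> smooth_on S (f i)) \<Longrightarrow> smooth_on S (\<lambda>x. \<Sum>i\<in>I. f i x)"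
  by (simp add: smooth_on_def Ck_on_sum)

lemma smooth_on_bilinear:
  "bounded_bilinear B \<Longrightarrow> open S \<Longrightarrow> smooth_on S f \<Longrightarrow> smooth_on S g \<Longrightarrow> smooth_on S (\<lambda>x. B (f x) (g x))"
  by (simp add: smooth_on_def Ck_on_bilinear)

lemmas smooth_on_mult = smooth_on_bilinear[OF bounded_bilinear_mult]
  and smooth_on_scaleR = smooth_on_bilinear[OF bounded_bilinear_scaleR]
  and smooth_on_inner = smooth_on_bilinear[OF bounded_bilinear_inner]

lemma smooth_on_diff:
  assumes "open S" "smooth_on S f" "smooth_on S g"
  shows "smooth_on S (\<lambda>x. f x - g x)"
  using smooth_on_add[OF assms(1,2) smooth_on_scaleR[OF assms(1) smooth_on_const[OF assms(1), of "-1"] assms(3)]]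
  by simp

lemma smooth_on_compose:
  fixes f :: "'b::euclidean_space \<Rightarrow> 'c::real_normed_vector" and g :: "'a::real_normed_vector \<Rightarrow> 'b"
  shows "open S \<Longrightarrow> smooth_on T f \<Longrightarrow> smooth_on S g \<Longrightarrow> g ` S \<subseteq> T \<Longrightarrow> smooth_on S (\<lambda>x. f (g x))"
  unfolding smooth_on_def using Ck_on_compose by blast

lemma smooth_on_Un: "open S \<Longrightarrow> open T \<Longrightarrow> smooth_on S f \<Longrightarrow> smooth_on T f \<Longrightarrow> smooth_on (S \<union> T) f"
  by (simp add: smooth_on_def Ck_on_Un)

lemma smooth_on_frechet: "smooth_on S f \<Longrightarrow> smooth_on S (\<lambda>x. frechet_derivative f (at x) v)"
  unfolding smooth_on_def by (metis Ck_on.simps(2))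

lemma smooth_on_has_derivative:
  "smooth_on S f \<Longrightarrow> x \<in> S \<Longrightarrow> (f has_derivative frechet_derivative f (at x)) (at x)"
  unfolding smooth_on_def by (metis Ck_on_has_derivative)

lemma smooth_on_continuous: "smooth_on S f \<Longrightarrow> continuous_on S f"
  unfolding smooth_on_def by (metis Ck_on.simps(1))

lemma smooth_on_inverse:
  fixes f :: "'a::real_normed_vector \<Rightarrow> real"
  assumes "open S" "smooth_on S f" "\<And>x. x \<in> S \<Longrightarrow> f x \<noteq> 0"
  shows "smooth_on S (\<lambda>x. inverse (f x))"
proof -
  have "Ck_on k (-{0}) (inverse :: real \<Rightarrow> real)" for k
  proof (induction k)
    case 0
    show ?case by (auto intro!: continuous_intros)
  next
    case (Suc k)
    show ?case
    proof (rule Ck_on_SucI)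
      fix x :: real assume "x \<in> -{0}"
      then show "(inverse has_derivative (\<lambda>v. (- v) * (inverse x * inverse x))) (at x)"
        by (auto intro!: derivative_eq_intros simp: fun_eq_iff algebra_simps)
    qed (intro open_Compl closed_singleton Ck_on_bilinear[OF bounded_bilinear_mult] Ck_on_const Suc)+
  qed
  then have "smooth_on (-{0}) (inverse :: real \<Rightarrow> real)" by (simp add: smooth_on_def)
  from smooth_on_compose[OF assms(1) this assms(2)] assms(3) show ?thesis by fastforce
qed

section \<open>A flat function\<close>

text \<open>The case \<open>n = 0\<close> is \<open>exp (-1/s)\<close> extended by zero, from which bump functions are made. The powers
  of \<open>1/s\<close> are there because the derivatives of this function are linear combinations of the
  \<open>flat n\<close>, so smoothness of all of them can be shown by one induction.\<close>

definition flat :: "nat \<Rightarrow> real \<Rightarrow> real" where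
  "flat n s = (if s > 0 then inverse s ^ n * exp (- inverse s) else 0)"

lemma flat_tendsto_0: "(flat n \<longlongrightarrow> 0) (at 0)"
proof (rule filterlim_split_at)
  show "(flat n \<longlongrightarrow> 0) (at_left 0)"
    by (rule tendsto_eventually) (auto simp: eventually_at_filter flat_def)
  have "((\<lambda>s. inverse s ^ n / exp (inverse s)) \<longlongrightarrow> (0::real)) (at_right 0)"
    by (rule filterlim_compose[OF tendsto_power_div_exp_0 filterlim_inverse_at_top_right])
  then show "(flat n \<longlongrightarrow> 0) (at_right 0)"
    by (rule Lim_transform_eventually) (auto simp: eventually_at_filter flat_def exp_minus field_simps)
qed

lemma flat_has_derivative:
  "(flat n has_derivative (\<lambda>v. v * (flat (n + 2) s + - real n * flat (n + 1) s))) (at s)"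
proof -
  have "(flat n has_field_derivative flat (n + 2) s + - real n * flat (n + 1) s) (at s)"
  proof (cases "s = 0")
    case True
    \<comment> \<open>The difference quotient at \<open>0\<close> is the next function of the family, \<open>flat (n + 1)\<close>.\<close>
    have "((\<lambda>y. (flat n y - flat n 0) / (y - 0)) \<longlongrightarrow> 0) (at 0)"
    proof (rule Lim_transform_eventually[OF flat_tendsto_0[of "n + 1"]])
      show "\<forall>\<^sub>F x in at 0. flat (n + 1) x = (flat n x - flat n 0) / (x - 0)"
        by (auto simp: eventually_at_filter flat_def field_simps)
    qed
    with True show ?thesis by (simp add: has_field_derivative_iff flat_def)
  next
    case False
    show ?thesis
    proof (cases "s > 0")
      case True
      have "((\<lambda>s. inverse s ^ n * exp (- inverse s)) has_field_derivative
          flat (n + 2) s + - real n * flat (n + 1) s) (at s)"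
      proof -
        have "((\<lambda>s. inverse s ^ n * exp (- inverse s)) has_field_derivative
            (real n * inverse s ^ (n - 1) * - (inverse s ^ 2)) * exp (- inverse s)
            + exp (- inverse s) * inverse s ^ 2 * inverse s ^ n) (at s)"
          using True by (auto intro!: derivative_eq_intros simp: power2_eq_square)
        also have "(real n * inverse s ^ (n - 1) * - (inverse s ^ 2)) * exp (- inverse s)
            + exp (- inverse s) * inverse s ^ 2 * inverse s ^ n = flat (n + 2) s + - real n * flat (n + 1) s"
          unfolding flat_def using True
          by (cases n) (simp_all add: algebra_simps power2_eq_square del: power_inverse inverse_mult_distrib)
        finally show ?thesis .
      qed
      then show ?thesis
        by (rule has_field_derivative_transform_within_open[where S = "{0<..}"]) (use True in \<open>auto simp: flat_def\<close>)
    next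
      case neg: False
      have "((\<lambda>s. 0) has_field_derivative flat (n + 2) s + - real n * flat (n + 1) s) (at s)"
        using neg by (simp add: flat_def)
      then show ?thesis
        by (rule has_field_derivative_transform_within_open[where S = "{..<0}"]) (use neg False in \<open>auto simp: flat_def\<close>)
    qed
  qed
  moreover have "(*) c = (\<lambda>v. v * c)" for c :: real
    by (simp add: fun_eq_iff)
  ultimately show ?thesis
    unfolding has_field_derivative_def by metis
qed

lemma smooth_on_flat: "smooth_on UNIV (flat n)"
proof -
  have "Ck_on k UNIV (flat n)" for k
  proof (induction k arbitrary: n)
    case 0
    show ?case
      using flat_has_derivative has_derivative_continuous continuous_at_imp_continuous_on by (metis Ck_on.simps(1))
  next
    case (Suc k)
    show ?case
      by (rule Ck_on_SucI[OF _ flat_has_derivative])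
        (intro Ck_on_bilinear[OF bounded_bilinear_mult] Ck_on_const Ck_on_add Suc open_UNIV)+
  qed
  then show ?thesis by (simp add: smooth_on_def)
qed

section \<open>Symmetry of second derivatives\<close>

text \<open>Two applications of the mean value theorem, first in direction \<open>u\<close> and then in direction \<open>v\<close>.
  The left-hand side of the equation is symmetric in \<open>u\<close> and \<open>v\<close>, the right-hand side is not: this
  is the source of the symmetry of second derivatives.\<close>

lemma second_difference:
  fixes f :: "'a::real_normed_vector \<Rightarrow> real"
  assumes f: "smooth_on S f" and "0 < s"
    and S: "\<And>a b. \<lbrakk>0 \<le> a; a \<le> s; 0 \<le> b; b \<le> s\<rbrakk> \<Longrightarrow> x + a *\<^sub>R u + b *\<^sub>R v \<in> S"
  obtains a b where "0 \<le> a" "a \<le> s" "0 \<le> b" "b \<le> s"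
    "f (x + s *\<^sub>R u + s *\<^sub>R v) - f (x + s *\<^sub>R u) - f (x + s *\<^sub>R v) + f x =
      s * s * frechet_derivative (\<lambda>y. frechet_derivative f (at y) u) (at (x + a *\<^sub>R u + b *\<^sub>R v)) v"
proof -
  let ?D = "\<lambda>y. frechet_derivative f (at y)"
  let ?E = "\<lambda>y. frechet_derivative (\<lambda>y. ?D y u) (at y)"
  have df: "((\<lambda>a. f (x + a *\<^sub>R u + b *\<^sub>R v)) has_derivative (\<lambda>h. ?D (x + a *\<^sub>R u + b *\<^sub>R v) (h *\<^sub>R u))) (at a)"
    if "0 \<le> a" "a \<le> s" "0 \<le> b" "b \<le> s" for a b
    by (rule has_derivative_compose[where f = "\<lambda>a. x + a *\<^sub>R u + b *\<^sub>R v", OF _ smooth_on_has_derivative[OF f S[OF that]]])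
      (auto intro!: derivative_eq_intros)
  have dE: "((\<lambda>b. ?D (x + a *\<^sub>R u + b *\<^sub>R v) u) has_derivative (\<lambda>h. ?E (x + a *\<^sub>R u + b *\<^sub>R v) (h *\<^sub>R v))) (at b)"
    if "0 \<le> a" "a \<le> s" "0 \<le> b" "b \<le> s" for a b
    by (rule has_derivative_compose[where f = "\<lambda>b. x + a *\<^sub>R u + b *\<^sub>R v",
          OF _ smooth_on_has_derivative[OF smooth_on_frechet[OF f] S[OF that]]])
      (auto intro!: derivative_eq_intros)
  define p where "p a = f (x + a *\<^sub>R u + s *\<^sub>R v) - f (x + a *\<^sub>R u)" for a
  have dp: "(p has_derivative (\<lambda>h. ?D (x + a *\<^sub>R u + s *\<^sub>R v) (h *\<^sub>R u) - ?D (x + a *\<^sub>R u) (h *\<^sub>R u))) (at a)"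
    if "0 \<le> a" "a \<le> s" for a
    using has_derivative_diff[OF df[of a s] df[of a 0]] that \<open>0 < s\<close> by (simp add: p_def[abs_def])
  obtain a where a: "0 < a" "a < s"
    "p s - p 0 = ?D (x + a *\<^sub>R u + s *\<^sub>R v) ((s - 0) *\<^sub>R u) - ?D (x + a *\<^sub>R u) ((s - 0) *\<^sub>R u)"
    using mvt_simple[OF \<open>0 < s\<close> has_derivative_at_withinI[OF dp]] by auto
  obtain b where b: "0 < b" "b < s"
    "?D (x + a *\<^sub>R u + s *\<^sub>R v) u - ?D (x + a *\<^sub>R u + 0 *\<^sub>R v) u = ?E (x + a *\<^sub>R u + b *\<^sub>R v) ((s - 0) *\<^sub>R v)"
    using mvt_simple[OF \<open>0 < s\<close> has_derivative_at_withinI[OF dE[of a]]] a by auto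
  have lD: "?D y (s *\<^sub>R u) = s * ?D y u" if "y \<in> S" for y
    using linear_scale[OF has_derivative_linear[OF smooth_on_has_derivative[OF f that]]] by simp
  have lE: "?E y (s *\<^sub>R v) = s * ?E y v" if "y \<in> S" for y
    using linear_scale[OF has_derivative_linear[OF smooth_on_has_derivative[OF smooth_on_frechet[OF f] that]]] by simp
  have "p s - p 0 = s * (?D (x + a *\<^sub>R u + s *\<^sub>R v) u - ?D (x + a *\<^sub>R u) u)"
    using a lD[OF S[of a s]] lD[OF S[of a 0]] \<open>0 < s\<close> by (simp add: algebra_simps)
  also have "\<dots> = s * s * ?E (x + a *\<^sub>R u + b *\<^sub>R v) v"
    using a b lE[OF S[of a b]] by simp
  finally show ?thesis
    using that[of a b] a b by (simp add: p_def)
qed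

text \<open>The second difference over a small parallelogram is \<open>s\<^sup>2\<close> times either mixed derivative, each at
  some nearby point. If the mixed derivatives differed at \<open>x\<close>, by continuity they would also differ
  at every two points close to \<open>x\<close>.\<close>

lemma smooth_on_second_derivative_symmetric:
  fixes f :: "'a::real_normed_vector \<Rightarrow> real"
  assumes "open S" and f: "smooth_on S f" and x: "x \<in> S"
  shows "frechet_derivative (\<lambda>y. frechet_derivative f (at y) u) (at x) v =
    frechet_derivative (\<lambda>y. frechet_derivative f (at y) v) (at x) u"
    (is "?P x = ?Q x")
proof (rule ccontr)
  assume "?P x \<noteq> ?Q x"
  define e where "e = \<bar>?P x - ?Q x\<bar> / 2"
  have e: "e > 0" using \<open>?P x \<noteq> ?Q x\<close> by (simp add: e_def)
  have cont: "continuous (at x) ?P" "continuous (at x) ?Q"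
    using smooth_on_continuous[OF smooth_on_frechet[OF smooth_on_frechet[OF f]]] assms
    by (simp_all add: continuous_on_eq_continuous_at)
  obtain d1 where d1: "d1 > 0" "\<And>y. dist y x < d1 \<Longrightarrow> dist (?P y) (?P x) < e"
    using cont(1) e unfolding continuous_at_eps_delta by blast
  obtain d2 where d2: "d2 > 0" "\<And>y. dist y x < d2 \<Longrightarrow> dist (?Q y) (?Q x) < e"
    using cont(2) e unfolding continuous_at_eps_delta by blast
  obtain d3 where d3: "d3 > 0" "ball x d3 \<subseteq> S"
    using assms open_contains_ball by blast
  define d where "d = min d1 (min d2 d3)"
  define s where "s = d / (2 * (norm u + norm v + 1))"
  have d: "d > 0" using d1 d2 d3 by (simp add: d_def)
  have n1: "norm u + norm v + 1 > 0" by (smt (verit) norm_ge_zero)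
  then have s: "s > 0" using d by (simp add: s_def)
  have near: "dist (x + a *\<^sub>R u + b *\<^sub>R v) x < d" if "0 \<le> a" "a \<le> s" "0 \<le> b" "b \<le> s" for a b
  proof -
    have "norm (a *\<^sub>R u + b *\<^sub>R v) \<le> a * norm u + b * norm v"
      using norm_triangle_ineq[of "a *\<^sub>R u" "b *\<^sub>R v"] that by simp
    also have "\<dots> \<le> s * norm u + s * norm v"
      using that by (intro add_mono mult_right_mono) auto
    also have "\<dots> \<le> s * (norm u + norm v + 1)"
      using s by (simp add: algebra_simps)
    also have "\<dots> = d / 2"
      using n1 unfolding s_def by (auto simp: divide_simps)
    also have "\<dots> < d" using d by simp
    finally show ?thesis by (simp add: dist_norm add.assoc)
  qed
  have inS: "x + a *\<^sub>R u + b *\<^sub>R v \<in> S" if "0 \<le> a" "a \<le> s" "0 \<le> b" "b \<le> s" for a b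
    using near[OF that] d3 by (auto simp: d_def dist_commute)
  obtain a b where ab: "0 \<le> a" "a \<le> s" "0 \<le> b" "b \<le> s"
    and 1: "f (x + s *\<^sub>R u + s *\<^sub>R v) - f (x + s *\<^sub>R u) - f (x + s *\<^sub>R v) + f x = s * s * ?P (x + a *\<^sub>R u + b *\<^sub>R v)"
    by (rule second_difference[OF f s inS])
  have inS': "x + b *\<^sub>R v + a *\<^sub>R u \<in> S" if "0 \<le> b" "b \<le> s" "0 \<le> a" "a \<le> s" for a b
    using inS[OF that(3,4,1,2)] by (simp add: algebra_simps)
  obtain b' a' where ab': "0 \<le> b'" "b' \<le> s" "0 \<le> a'" "a' \<le> s"
    and 2: "f (x + s *\<^sub>R v + s *\<^sub>R u) - f (x + s *\<^sub>R v) - f (x + s *\<^sub>R u) + f x = s * s * ?Q (x + b' *\<^sub>R v + a' *\<^sub>R u)"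
    by (rule second_difference[OF f s inS'])
  have "s * s * ?P (x + a *\<^sub>R u + b *\<^sub>R v) = s * s * ?Q (x + a' *\<^sub>R u + b' *\<^sub>R v)"
    using 1 2 by (simp add: algebra_simps)
  then have eq: "?P (x + a *\<^sub>R u + b *\<^sub>R v) = ?Q (x + a' *\<^sub>R u + b' *\<^sub>R v)"
    using s by simp
  have "dist (?P (x + a *\<^sub>R u + b *\<^sub>R v)) (?P x) < e" "dist (?Q (x + a' *\<^sub>R u + b' *\<^sub>R v)) (?Q x) < e"
    using near[OF ab] near[OF ab'(3,4,1,2)] by (auto intro!: d1(2) d2(2) simp: d_def)
  then have "\<bar>?P x - ?Q x\<bar> < 2 * e"
    unfolding eq dist_real_def by linarith
  then show False by (simp add: e_def)
qed

section \<open>Charts and transition maps\<close>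

locale smooth_atlas =
  fixes X :: "'a topology" and A :: "('a, 'n::finite) chart set"
  assumes smooth_manifold: "smooth_manifold X A"
begin

lemma is_chart: "c \<in> A \<Longrightarrow> is_chart X c"
  using smooth_manifold by (simp add: smooth_manifold_def)

lemma cdom_subset: "c \<in> A \<Longrightarrow> cdom c \<subseteq> topspace X"
  using is_chart openin_subset unfolding is_chart_def by blast

lemma open_cimg: "c \<in> A \<Longrightarrow> open (cimg c)"
  using is_chart unfolding is_chart_def by blast

lemma cmap_homeomorphic:
  "c \<in> A \<Longrightarrow> homeomorphic_map (subtopology X (cdom c)) (top_of_set (cimg c)) (cmap c)"
  using is_chart unfolding is_chart_def by blast

lemma inj_on_cmap: "c \<in> A \<Longrightarrow> inj_on (cmap c) (cdom c)"
  using homeomorphic_imp_injective_map[OF cmap_homeomorphic[of c]] cdom_subset[of c]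
  by (metis topspace_subtopology_subset)

lemma cmap_in [simp]: "p \<in> cdom c \<Longrightarrow> cmap c p \<in> cimg c"
  by (simp add: cimg_def)

lemma cinv_cmap [simp]: "c \<in> A \<Longrightarrow> p \<in> cdom c \<Longrightarrow> cinv c (cmap c p) = p"
  by (simp add: cinv_def inj_on_cmap)

lemma cinv_in [simp]: "x \<in> cimg c \<Longrightarrow> cinv c x \<in> cdom c"
  by (simp add: cinv_def cimg_def inv_into_into)

lemma cmap_cinv [simp]: "x \<in> cimg c \<Longrightarrow> cmap c (cinv c x) = x"
  by (simp add: cinv_def cimg_def f_inv_into_f)

lemma overlap_iff: "c \<in> A \<Longrightarrow> x \<in> overlap c d \<longleftrightarrow> x \<in> cimg c \<and> cinv c x \<in> cdom d"
  unfolding overlap_def by (auto simp: image_iff) (metis cinv_in cmap_cinv IntI)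

lemma overlap_self: "overlap c c = cimg c"
  by (simp add: overlap_def cimg_def)

lemma overlap_subset: "overlap c d \<subseteq> cimg c"
  by (auto simp: overlap_def cimg_def)

lemma open_chart_preimage:
  assumes "c \<in> A" "openin X U"
  shows "open {x \<in> cimg c. cinv c x \<in> U}"
proof -
  have "openin (subtopology X (cdom c)) (cdom c \<inter> U)"
    using assms by (auto simp: openin_subtopology)
  then have "openin (top_of_set (cimg c)) (cmap c ` (cdom c \<inter> U))"
    using homeomorphic_map_openness_eq[OF cmap_homeomorphic[OF assms(1)]] by blast
  then have "open (cmap c ` (cdom c \<inter> U))"
    using open_cimg[OF assms(1)] openin_open_eq by blast
  moreover have "cmap c ` (cdom c \<inter> U) = {x \<in> cimg c. cinv c x \<in> U}"
    using assms by (auto simp: image_iff) (metis cinv_in cmap_cinv IntI)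
  ultimately show ?thesis by simp
qed

lemma continuous_cinv:
  assumes "c \<in> A"
  shows "continuous_map (top_of_set (cimg c)) X (cinv c)"
proof -
  have "openin (top_of_set (cimg c)) {x \<in> cimg c. cinv c x \<in> U}" if "openin X U" for U
    using open_chart_preimage[OF assms that] by (auto intro: open_openin_trans[OF open_cimg[OF assms]])
  then show ?thesis
    using cdom_subset[OF assms] by (auto simp: continuous_map_def)
qed

lemma openin_chart_preimage:
  assumes "c \<in> A" "open V"
  shows "openin X {p \<in> cdom c. cmap c p \<in> V}"
proof -
  have "continuous_map (subtopology X (cdom c)) (top_of_set (cimg c)) (cmap c)"
    using cmap_homeomorphic[OF assms(1)] by (rule homeomorphic_imp_continuous_map)
  then have "continuous_map (subtopology X (cdom c)) euclidean (cmap c)"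
    by (simp add: continuous_map_in_subtopology)
  then have "openin (subtopology X (cdom c)) {p \<in> topspace (subtopology X (cdom c)). cmap c p \<in> V}"
    using assms(2) openin_continuous_map_preimage by fastforce
  moreover have "openin X (cdom c)"
    using is_chart[OF assms(1)] by (simp add: is_chart_def)
  ultimately have "openin X {p \<in> topspace (subtopology X (cdom c)). cmap c p \<in> V}"
    using openin_trans_full by blast
  then show ?thesis
    unfolding topspace_subtopology_subset[OF cdom_subset[OF assms(1)]] .
qed

lemma open_overlap: "c \<in> A \<Longrightarrow> d \<in> A \<Longrightarrow> open (overlap c d)"
  using open_chart_preimage[of c "cdom d"] is_chart[of d] by (simp add: is_chart_def overlap_iff[symmetric])

lemma cinv_transition [simp]:
  "c \<in> A \<Longrightarrow> d \<in> A \<Longrightarrow> x \<in> overlap c d \<Longrightarrow> cinv d (transition c d x) = cinv c x"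
  by (simp add: transition_def overlap_iff)

lemma transition_in: "c \<in> A \<Longrightarrow> d \<in> A \<Longrightarrow> x \<in> overlap c d \<Longrightarrow> transition c d x \<in> overlap d c"
  by (simp add: transition_def overlap_iff)

lemma transition_cimg: "c \<in> A \<Longrightarrow> d \<in> A \<Longrightarrow> x \<in> overlap c d \<Longrightarrow> transition c d x \<in> cimg d"
  by (simp add: transition_def overlap_iff)

lemma smooth_transition: "c \<in> A \<Longrightarrow> d \<in> A \<Longrightarrow> smooth_on (overlap c d) (transition c d)"
  using smooth_manifold by (auto simp: smooth_manifold_def compatible_def)

lemma transition_has_derivative:
  "c \<in> A \<Longrightarrow> d \<in> A \<Longrightarrow> x \<in> overlap c d \<Longrightarrow> (transition c d has_derivative jac c d x) (at x)"
  unfolding jac_def by (rule smooth_on_has_derivative[OF smooth_transition])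

lemma linear_jac: "c \<in> A \<Longrightarrow> d \<in> A \<Longrightarrow> x \<in> overlap c d \<Longrightarrow> linear (jac c d x)"
  using transition_has_derivative has_derivative_linear by blast

lemma smooth_jac: "c \<in> A \<Longrightarrow> d \<in> A \<Longrightarrow> smooth_on (overlap c d) (\<lambda>x. jac c d x v)"
  unfolding jac_def by (rule smooth_on_frechet[OF smooth_transition])

lemma jac_chain:
  assumes "c \<in> A" "d \<in> A" "e \<in> A" "x \<in> overlap c d" "x \<in> overlap c e"
  shows "jac c e x v = jac d e (transition c d x) (jac c d x v)"
proof -
  have x': "transition c d x \<in> overlap d e"
    using assms by (simp add: overlap_iff transition_def)
  have "((\<lambda>y. transition d e (transition c d y)) has_derivative
      (\<lambda>v. jac d e (transition c d x) (jac c d x v))) (at x)"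
    using assms x' by (intro has_derivative_compose[OF transition_has_derivative transition_has_derivative])
  then have "(transition c e has_derivative (\<lambda>v. jac d e (transition c d x) (jac c d x v))) (at x)"
  proof (rule has_derivative_transform_within_open)
    show "open (overlap c d)" "x \<in> overlap c d"
      using assms open_overlap by auto
    show "transition d e (transition c d y) = transition c e y" if "y \<in> overlap c d" for y
      using assms that by (simp add: transition_def overlap_iff)
  qed
  then show ?thesis
    using has_derivative_unique[OF transition_has_derivative[of c e x]] assms by metis
qed

lemma jac_self:
  assumes "c \<in> A" "x \<in> cimg c"
  shows "jac c c x v = v"
proof -
  have "((\<lambda>y. y) has_derivative (\<lambda>v. v)) (at x)" by simp
  then have "(transition c c has_derivative (\<lambda>v. v)) (at x)"
    by (rule has_derivative_transform_within_open[OF _ open_cimg[OF assms(1)] assms(2)])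
      (simp add: transition_def)
  then show ?thesis
    using has_derivative_unique[OF transition_has_derivative[of c c x]] assms by (metis overlap_self)
qed

section \<open>Bump functions and partitions of unity\<close>

text \<open>Glues a function that is smooth on the overlap with a chart \<open>c\<close> to zero outside a closed subset
  of the domain of \<open>c\<close>. The two open sets cover the image of \<open>d\<close> since the closed set lies in the
  domain of \<open>c\<close>.\<close>

lemma smooth_on_extend_zero:
  fixes f :: "real ^ 'n \<Rightarrow> 'b::real_normed_vector"
  assumes "c \<in> A" "d \<in> A" and K: "closedin X K" "K \<subseteq> cdom c"
    and f: "smooth_on (overlap d c) f" "\<And>y. y \<in> cimg d \<Longrightarrow> cinv d y \<notin> K \<Longrightarrow> f y = 0"
  shows "smooth_on (cimg d) f"
proof -
  let ?U = "{y \<in> cimg d. cinv d y \<in> topspace X - K}"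
  have U: "open ?U"
    using open_chart_preimage assms by blast
  have "smooth_on ?U f = smooth_on ?U (\<lambda>y. 0 :: 'b)"
    by (rule smooth_on_cong[OF U]) (simp add: f)
  then have "smooth_on ?U f" using smooth_on_const[OF U] by blast
  with f(1) have "smooth_on (overlap d c \<union> ?U) f"
    using U open_overlap assms by (intro smooth_on_Un)
  moreover have "overlap d c \<union> ?U = cimg d"
    using assms cdom_subset[OF assms(2)] by (auto simp: overlap_iff)
  ultimately show ?thesis by simp
qed

text \<open>In the chart, \<open>b\<close> is \<open>flat 0 (r\<^sup>2 - dist\<^sup>2)\<close> around the given point. The closed ball is compact and
  \<open>X\<close> is Hausdorff, so its preimage is closed in the whole manifold and extension by zero is smooth.\<close>

lemma bump_function:
  assumes c: "c \<in> A" and p: "p \<in> cdom c"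
  obtains b where "smooth_fun A b" "\<forall>q. 0 \<le> b q" "b p > 0"
    "openin X {q \<in> topspace X. 0 < b q}" "X closure_of {q \<in> topspace X. b q \<noteq> 0} \<subseteq> cdom c"
proof -
  let ?a = "cmap c p"
  obtain r where r: "r > 0" "cball ?a r \<subseteq> cimg c"
    using open_cimg[OF c] p open_contains_cball cmap_in by metis
  define h where "h x = flat 0 (r\<^sup>2 - (x - ?a) \<bullet> (x - ?a))" for x
  define b where "b q = (if q \<in> cdom c then h (cmap c q) else 0)" for q
  have h_pos: "h x > 0 \<longleftrightarrow> x \<in> ball ?a r" and h_nonneg: "h x \<ge> 0" for x
  proof -
    have "(x - ?a) \<bullet> (x - ?a) < r\<^sup>2 \<longleftrightarrow> dist ?a x < r"
      using r(1) by (simp add: dist_norm norm_minus_commute dot_square_norm power_mono_iff abs_le_square_iff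
          flip: power2_norm_eq_inner)
        (smt (verit) norm_ge_zero power2_less_imp_less power_strict_mono zero_less_numeral)
    then show "h x > 0 \<longleftrightarrow> x \<in> ball ?a r" "h x \<ge> 0"
      by (auto simp: h_def flat_def)
  qed
  have h_smooth: "smooth_on UNIV h"
    unfolding h_def
    by (rule smooth_on_compose[OF open_UNIV smooth_on_flat])
      (intro smooth_on_diff smooth_on_inner smooth_on_const smooth_on_linear[OF _ bounded_linear_ident]
        open_UNIV subset_UNIV)+
  define K where "K = cinv c ` cball ?a r"
  have "compactin (top_of_set (cimg c)) (cball ?a r)"
    using r(2) by (simp add: compactin_subtopology)
  then have "compactin X K"
    unfolding K_def using continuous_cinv[OF c] by (rule image_compactin)
  then have K: "closedin X K"
    using smooth_manifold by (auto simp: smooth_manifold_def intro: compactin_imp_closedin)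
  have Kc: "K \<subseteq> cdom c"
    using r(2) by (auto simp: K_def)
  have supp: "q \<in> K" if "b q \<noteq> 0" for q
  proof -
    have "q \<in> cdom c" "h (cmap c q) > 0"
      using that h_nonneg[of "cmap c q"] by (auto simp: b_def split: if_splits)
    then have "cmap c q \<in> cball ?a r" using h_pos by auto
    then show ?thesis
      unfolding K_def using \<open>q \<in> cdom c\<close> c by (metis cinv_cmap image_eqI)
  qed
  have "smooth_fun A b"
    unfolding smooth_fun_def
  proof
    fix d assume d: "d \<in> A"
    have "smooth_on (overlap d c) (\<lambda>y. h (transition d c y))"
      by (rule smooth_on_compose[OF open_overlap[OF d c] h_smooth smooth_transition[OF d c]]) simp
    moreover have "smooth_on (overlap d c) (\<lambda>y. h (transition d c y)) = smooth_on (overlap d c) (b \<circ> cinv d)"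
      by (rule smooth_on_cong[OF open_overlap[OF d c]])
        (use d c in \<open>simp add: b_def overlap_iff transition_def\<close>)
    ultimately show "smooth_on (cimg d) (b \<circ> cinv d)"
      using supp by (intro smooth_on_extend_zero[OF c d K Kc]) auto
  qed
  moreover have "{q \<in> topspace X. 0 < b q} = {q \<in> cdom c. cmap c q \<in> ball ?a r}"
    using cdom_subset[OF c] h_pos by (auto simp: b_def)
  then have "openin X {q \<in> topspace X. 0 < b q}"
    using openin_chart_preimage[OF c open_ball] by simp
  moreover have "X closure_of {q \<in> topspace X. b q \<noteq> 0} \<subseteq> K"
    by (rule closure_of_minimal[OF _ K]) (use supp in auto)
  moreover have "b p > 0"
    using h_pos p r(1) by (simp add: b_def)
  ultimately show ?thesis
    using that[of b] h_nonneg Kc by (auto simp: b_def)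
qed

text \<open>Finitely many bump functions have positive sum everywhere, by compactness. Those that belong to
  the same chart are added up, and the results are divided by the total sum.\<close>

lemma partition_of_unity_exists:
  assumes "compact_space X" "Or \<subseteq> A" "(\<Union>c\<in>Or. cdom c) = topspace X"
  shows "\<exists>C \<rho>. partition_of_unity X A Or C \<rho>"
proof -
  define good where "good p c b \<longleftrightarrow> c \<in> Or \<and> smooth_fun A b \<and> (\<forall>q. 0 \<le> b q) \<and> b p > 0 \<and>
    openin X {q \<in> topspace X. 0 < b q} \<and> X closure_of {q \<in> topspace X. b q \<noteq> 0} \<subseteq> cdom c" for p c b
  have "\<exists>c b. good p c b" if "p \<in> topspace X" for p
  proof -
    have "p \<in> (\<Union>c\<in>Or. cdom c)" using that assms(3) by simp
    then obtain c where c: "c \<in> Or" "p \<in> cdom c" by (rule UN_E)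
    with assms(2) have "c \<in> A" by blast
    then obtain b where "smooth_fun A b" "\<forall>q. 0 \<le> b q" "b p > 0"
      "openin X {q \<in> topspace X. 0 < b q}" "X closure_of {q \<in> topspace X. b q \<noteq> 0} \<subseteq> cdom c"
      by (rule bump_function[OF _ c(2)])
    with c(1) have "good p c b" by (simp add: good_def)
    then show ?thesis by blast
  qed
  then have "\<forall>p. \<exists>cb. p \<in> topspace X \<longrightarrow> good p (fst cb) (snd cb)" by auto
  from choice[OF this] obtain cb where
    "\<forall>p. p \<in> topspace X \<longrightarrow> good p (fst (cb p)) (snd (cb p))" ..
  then have cb': "good p (fst (cb p)) (snd (cb p))" if "p \<in> topspace X" for p
    using that by simp
  define c b where "c p = fst (cb p)" and "b p = snd (cb p)" for p
  note cb = cb'[folded c_def b_def, unfolded good_def]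
  define U where "U p = {q \<in> topspace X. 0 < b p q}" for p
  have "\<exists>\<F>. finite \<F> \<and> \<F> \<subseteq> U ` topspace X \<and> topspace X \<subseteq> \<Union>\<F>"
  proof -
    have "\<forall>V\<in>U ` topspace X. openin X V" "topspace X \<subseteq> \<Union>(U ` topspace X)"
      using cb by (auto simp: U_def)
    then show ?thesis
      using assms(1) unfolding compact_space_alt by blast
  qed
  then obtain P where P: "finite P" "P \<subseteq> topspace X" "topspace X \<subseteq> (\<Union>p\<in>P. U p)"
    by (metis finite_subset_image)
  define s where "s q = (\<Sum>p\<in>P. b p q)" for q
  have s_pos: "s q > 0" if q: "q \<in> topspace X" for q
  proof -
    obtain p where p: "p \<in> P" "q \<in> U p" using P q by blast
    have "0 < b p q" using p by (simp add: U_def)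
    also have "\<dots> \<le> s q"
      unfolding s_def using p P cb by (intro member_le_sum) auto
    finally show ?thesis .
  qed
  \<comment> \<open>Several of the chosen points may have the same chart, hence the sum over a fibre of \<open>c\<close>.\<close>
  define \<rho> where "\<rho> e q = (\<Sum>p | p \<in> P \<and> c p = e. b p q) * inverse (s q)" for e q
  have "partition_of_unity X A Or (c ` P) \<rho>"
    unfolding partition_of_unity_def
  proof (intro conjI ballI)
    show "finite (c ` P)" using P by simp
    show "c ` P \<subseteq> Or" using P cb by auto
  next
    fix e assume "e \<in> c ` P"
    show "smooth_fun A (\<rho> e)"
      unfolding smooth_fun_def o_def
    proof
      fix d assume d: "d \<in> A"
      have bs: "smooth_on (cimg d) (\<lambda>x. b p (cinv d x))" if "p \<in> P" for p
        using cb[of p] P that d by (auto simp: smooth_fun_def o_def)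
      have pos: "s (cinv d x) \<noteq> 0" if "x \<in> cimg d" for x
        using s_pos[of "cinv d x"] that cdom_subset[OF d] cinv_in by fastforce
      show "smooth_on (cimg d) (\<lambda>x. \<rho> e (cinv d x))"
        unfolding \<rho>_def
      proof (intro smooth_on_mult smooth_on_sum smooth_on_inverse open_cimg d)
        show "smooth_on (cimg d) (\<lambda>x. s (cinv d x))"
          unfolding s_def by (intro smooth_on_sum open_cimg d bs)
      qed (use bs pos in auto)
    qed
  next
    fix e q assume "q \<in> topspace X"
    then show "0 \<le> \<rho> e q"
      unfolding \<rho>_def using s_pos[of q] P cb by (intro mult_nonneg_nonneg sum_nonneg) auto
  next
    fix e assume "e \<in> c ` P"
    let ?P = "{p \<in> P. c p = e}"
    have "{q \<in> topspace X. \<rho> e q \<noteq> 0} \<subseteq> \<Union>((\<lambda>p. {q \<in> topspace X. b p q \<noteq> 0}) ` ?P)"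
    proof
      fix q assume "q \<in> {q \<in> topspace X. \<rho> e q \<noteq> 0}"
      moreover from this have "\<exists>p\<in>?P. b p q \<noteq> 0"
        unfolding \<rho>_def using sum.not_neutral_contains_not_neutral[of "\<lambda>p. b p q" ?P] by auto
      ultimately show "q \<in> \<Union>((\<lambda>p. {q \<in> topspace X. b p q \<noteq> 0}) ` ?P)" by auto
    qed
    then have "X closure_of {q \<in> topspace X. \<rho> e q \<noteq> 0} \<subseteq>
        X closure_of \<Union>((\<lambda>p. {q \<in> topspace X. b p q \<noteq> 0}) ` ?P)"
      by (rule closure_of_mono)
    also have "\<dots> = (\<Union>p\<in>?P. X closure_of {q \<in> topspace X. b p q \<noteq> 0})"
      using P by (subst closure_of_Union) auto
    also have "\<dots> \<subseteq> cdom e"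
      using cb P by blast
    finally show "X closure_of {q \<in> topspace X. \<rho> e q \<noteq> 0} \<subseteq> cdom e" .
  next
    fix q assume q: "q \<in> topspace X"
    have "(\<Sum>e\<in>c ` P. \<rho> e q) = (\<Sum>e\<in>c ` P. \<Sum>p | p \<in> P \<and> c p = e. b p q) * inverse (s q)"
      by (simp add: \<rho>_def sum_distrib_right)
    also have "(\<Sum>e\<in>c ` P. \<Sum>p | p \<in> P \<and> c p = e. b p q) = s q"
      unfolding s_def using sum.image_gen[OF P(1), of "\<lambda>p. b p q" c] by simp
    finally show "(\<Sum>e\<in>c ` P. \<rho> e q) = 1"
      using s_pos[OF q] by simp
  qed
  then show ?thesis by blast
qed

text \<open>The field that is constant \<open>v\<close> in the chart \<open>c\<close>, cut off by a bump function that is normalised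
  at the given point. In another chart it is transported by the Jacobian, and the transformation law
  is the chain rule \<open>jac_chain\<close>.\<close>

lemma vector_field_extension:
  assumes c: "c \<in> A" and x: "x \<in> cimg c"
  obtains W where "vector_field A W" "W c x = v"
proof -
  obtain b where b: "smooth_fun A b" "b (cinv c x) > 0" "X closure_of {q \<in> topspace X. b q \<noteq> 0} \<subseteq> cdom c"
    by (rule bump_function[OF c cinv_in[OF x]])
  define K where "K = X closure_of {q \<in> topspace X. b q \<noteq> 0}"
  have K: "closedin X K" "K \<subseteq> cdom c" using b by (simp_all add: K_def)
  have supp: "b q = 0" if "q \<in> topspace X" "q \<notin> K" for q
  proof (rule ccontr)
    assume "b q \<noteq> 0"
    then have "q \<in> {q \<in> topspace X. b q \<noteq> 0}" using that by simp
    also have "\<dots> \<subseteq> K" unfolding K_def by (rule closure_of_subset) auto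
    finally show False using that by simp
  qed
  define W where "W d y = (if y \<in> overlap d c
    then (b (cinv d y) / b (cinv c x)) *\<^sub>R jac c d (transition d c y) v else 0)" for d y
  have "vector_field A W"
    unfolding vector_field_def
  proof (intro conjI ballI)
    fix d assume d: "d \<in> A"
    have ov: "open (overlap d c)" using open_overlap d c by blast
    have 1: "smooth_on (overlap d c) (\<lambda>y. jac c d (transition d c y) v)"
      by (rule smooth_on_compose[OF ov smooth_jac[OF c d] smooth_transition[OF d c]])
        (use transition_in[OF d c] in auto)
    have "smooth_on (cimg d) (\<lambda>y. b (cinv d y))"
      using b(1) d by (simp add: smooth_fun_def o_def)
    from smooth_on_subset[OF this overlap_subset[of d c]]
    have 2: "smooth_on (overlap d c) (\<lambda>y. b (cinv d y) / b (cinv c x))"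
      unfolding divide_inverse by (intro smooth_on_mult ov smooth_on_const)
    have "smooth_on (overlap d c) (W d) =
        smooth_on (overlap d c) (\<lambda>y. (b (cinv d y) / b (cinv c x)) *\<^sub>R jac c d (transition d c y) v)"
      by (rule smooth_on_cong[OF ov]) (simp add: W_def)
    then have "smooth_on (overlap d c) (W d)"
      using smooth_on_scaleR[OF ov 2 1] by simp
    then show "smooth_on (cimg d) (W d)"
    proof (rule smooth_on_extend_zero[OF c d K])
      fix y assume y: "y \<in> cimg d" "cinv d y \<notin> K"
      have "cinv d y \<in> topspace X" using y cdom_subset[OF d] cinv_in by blast
      then show "W d y = 0" using supp y by (simp add: W_def)
    qed
  next
    fix d e y assume d: "d \<in> A" and e: "e \<in> A" and y: "y \<in> overlap d e"
    show "W e (transition d e y) = jac d e y (W d y)"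
    proof (cases "cinv d y \<in> cdom c")
      case False
      then show ?thesis
        using y d e linear_0[OF linear_jac[OF d e y]] by (simp add: W_def overlap_iff transition_def)
    next
      case True
      let ?z = "transition d c y"
      have yc: "y \<in> overlap d c" using True y d by (simp add: overlap_iff)
      have z: "?z \<in> overlap c d" "?z \<in> overlap c e" "transition c d ?z = y"
        "transition e c (transition d e y) = ?z" "transition d e y \<in> overlap e c"
        using True y d e c by (simp_all add: overlap_iff transition_def)
      show ?thesis
        using jac_chain[OF c d e z(1,2)] linear_scale[OF linear_jac[OF d e y]] z(3-5) yc
          cinv_transition[OF d e y] by (simp add: W_def)
    qed
  qed
  moreover have "W c x = v"
    using b x c by (simp add: W_def overlap_self jac_self transition_def)
  ultimately show ?thesis using that by blast
qed

end

section \<open>Integrals of forms of quadratic size\<close>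

lemma has_real_derivative_0_quadratic:
  fixes f :: "real \<Rightarrow> real"
  assumes "\<delta> > 0" and bound: "\<And>t. \<bar>t\<bar> < \<delta> \<Longrightarrow> \<bar>f t\<bar> \<le> B * t\<^sup>2"
  shows "(f has_real_derivative 0) (at 0)"
proof -
  have f0: "f 0 = 0" using bound[of 0] assms(1) by simp
  have "((\<lambda>t. f t / t) \<longlongrightarrow> 0) (at 0)"
  proof (rule Lim_null_comparison)
    show "((\<lambda>t. B * \<bar>t\<bar>) \<longlongrightarrow> 0) (at 0)"
      by (auto intro!: tendsto_eq_intros)
    show "\<forall>\<^sub>F t in at 0. norm (f t / t) \<le> B * \<bar>t\<bar>"
      unfolding eventually_at
    proof (intro exI conjI ballI impI)
      fix t :: real assume "t \<in> UNIV" "t \<noteq> 0 \<and> dist t 0 < \<delta>"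
      then have "\<bar>f t\<bar> \<le> B * t\<^sup>2" "t \<noteq> 0" using bound by (auto simp: dist_real_def)
      moreover have "t\<^sup>2 = \<bar>t\<bar> * \<bar>t\<bar>" by (simp add: power2_eq_square)
      ultimately show "norm (f t / t) \<le> B * \<bar>t\<bar>"
        by (simp add: abs_divide divide_le_eq)
    qed (use assms in auto)
  qed
  then show ?thesis by (simp add: has_field_derivative_iff f0)
qed

text \<open>If \<open>f\<close> is not integrable, its gauge integral is \<open>0\<close> by convention and the bound is trivial.
  Otherwise \<open>\<bar>f\<bar>\<close> is compared with \<open>M\<close> times the indicator of \<open>K\<close>.\<close>

lemma integral_bound_compact_support:
  fixes f :: "'a::euclidean_space \<Rightarrow> real"
  assumes K: "compact K" "K \<subseteq> U" and "M \<ge> 0"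
    and zero: "\<And>x. x \<in> U - K \<Longrightarrow> f x = 0" and bound: "\<And>x. x \<in> K \<Longrightarrow> \<bar>f x\<bar> \<le> M"
  shows "\<bar>integral U f\<bar> \<le> M * measure lebesgue K"
proof (cases "f integrable_on U")
  case True
  have Km: "K \<in> lmeasurable" using K by (simp add: lmeasurable_compact)
  have Mint: "(\<lambda>x. M) integrable_on K" using Km by (rule integrable_on_const)
  have "norm (integral UNIV (\<lambda>x. if x \<in> U then f x else 0)) \<le> integral UNIV (\<lambda>x. if x \<in> K then M else 0)"
  proof (rule integral_norm_bound_integral)
    show "(\<lambda>x. if x \<in> U then f x else 0) integrable_on UNIV"
      using True by (simp add: integrable_restrict_UNIV)
    show "(\<lambda>x. if x \<in> K then M else 0) integrable_on UNIV"
      using Mint by (simp add: integrable_restrict_UNIV)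
    show "norm (if x \<in> U then f x else 0) \<le> (if x \<in> K then M else 0)" for x
      using zero[of x] bound[of x] K by auto
  qed
  also have "integral UNIV (\<lambda>x. if x \<in> K then M else 0) = M * measure lebesgue K"
    using Km by (simp add: integral_restrict_UNIV lmeasure_integral flip: integral_mult_right)
  finally show ?thesis by (simp add: integral_restrict_UNIV)
next
  case False
  then show ?thesis using assms(3) by (simp add: not_integrable_integral)
qed

locale closed_oriented_3_manifold =
  fixes X :: "'a topology" and A Or :: "('a, 3) chart set"
  assumes closed_oriented: "closed_oriented_manifold X A Or"

sublocale closed_oriented_3_manifold \<subseteq> smooth_atlas X A
  using closed_oriented by unfold_locales (simp add: closed_oriented_manifold_def)

context closed_oriented_3_manifold
begin

lemma Or_subset: "Or \<subseteq> A"
  using closed_oriented by (simp add: closed_oriented_manifold_def orientation_def)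

text \<open>The integral is defined with a partition of unity picked by the choice operator; existence makes
  the picked object a genuine partition.\<close>

lemma form_integral_partition:
  obtains C \<rho> where "partition_of_unity X A Or C \<rho>"
    "\<And>\<theta>. form_integral X A Or \<theta> = (\<Sum>c\<in>C. integral (cimg c)
        (\<lambda>x. \<rho> c (cinv c x) * \<theta> c x (axis 1 1) (axis 2 1) (axis 3 1)))"
proof -
  let ?p = "SOME (C, \<rho>). partition_of_unity X A Or C \<rho>"
  obtain C \<rho> where p: "?p = (C, \<rho>)" by (cases ?p)
  have "\<exists>p. case p of (C, \<rho>) \<Rightarrow> partition_of_unity X A Or C \<rho>"
    using partition_of_unity_exists[of Or] closed_oriented
    by (simp add: closed_oriented_manifold_def orientation_def)
  then have "case ?p of (C, \<rho>) \<Rightarrow> partition_of_unity X A Or C \<rho>" by (rule someI_ex)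
  then have "partition_of_unity X A Or C \<rho>" by (simp add: p)
  then show ?thesis
    by (rule that) (simp add: form_integral_def p)
qed

lemma form_integral_zero:
  assumes "\<And>c x. c \<in> A \<Longrightarrow> x \<in> cimg c \<Longrightarrow> \<theta> c x (axis 1 1) (axis 2 1) (axis 3 1) = 0"
  shows "form_integral X A Or \<theta> = 0"
proof -
  obtain C \<rho> where C: "partition_of_unity X A Or C \<rho>"
    and int: "\<And>\<theta>. form_integral X A Or \<theta> = (\<Sum>c\<in>C. integral (cimg c)
        (\<lambda>x. \<rho> c (cinv c x) * \<theta> c x (axis 1 1) (axis 2 1) (axis 3 1)))"
    using form_integral_partition by blast
  have "integral (cimg c) (\<lambda>x. \<rho> c (cinv c x) * \<theta> c x (axis 1 1) (axis 2 1) (axis 3 1)) = 0" if "c \<in> C" for c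
  proof -
    have "c \<in> A" using C that Or_subset by (auto simp: partition_of_unity_def)
    then have "integral (cimg c) (\<lambda>x. \<rho> c (cinv c x) * \<theta> c x (axis 1 1) (axis 2 1) (axis 3 1)) =
        integral (cimg c) (\<lambda>x. 0)"
      by (intro integral_cong) (simp add: assms)
    then show ?thesis by simp
  qed
  then show ?thesis unfolding int by (intro sum.neutral) blast
qed

text \<open>The summand of each chart is cut off by a function with compact support in the chart, so a
  quadratic bound on compact sets gives a quadratic bound for the integral.\<close>

lemma form_integral_quadratic:
  assumes bound: "\<And>c K. c \<in> A \<Longrightarrow> compact K \<Longrightarrow> K \<subseteq> cimg c \<Longrightarrow>
    \<exists>B \<delta>. \<delta> > 0 \<and> B \<ge> 0 \<and> (\<forall>t x. \<bar>t\<bar> < \<delta> \<longrightarrow> x \<in> K \<longrightarrow>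
      \<bar>\<theta> t c x (axis 1 1) (axis 2 1) (axis 3 1)\<bar> \<le> B * t\<^sup>2)"
  shows "((\<lambda>t. form_integral X A Or (\<theta> t)) has_real_derivative 0) (at 0)"
proof -
  obtain C \<rho> where C: "partition_of_unity X A Or C \<rho>"
    and int: "\<And>\<theta>. form_integral X A Or \<theta> = (\<Sum>c\<in>C. integral (cimg c)
        (\<lambda>x. \<rho> c (cinv c x) * \<theta> c x (axis 1 1) (axis 2 1) (axis 3 1)))"
    using form_integral_partition by blast
  have "((\<lambda>t. integral (cimg c) (\<lambda>x. \<rho> c (cinv c x) * \<theta> t c x (axis 1 1) (axis 2 1) (axis 3 1)))
      has_real_derivative 0) (at 0)" if c: "c \<in> C" for c
  proof -
    have cA: "c \<in> A" using C c Or_subset by (auto simp: partition_of_unity_def)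
    \<comment> \<open>The support of \<open>\<rho> c\<close> is closed in a compact space, hence its image \<open>K\<close> in the chart is compact.\<close>
    define S where "S = X closure_of {p \<in> topspace X. \<rho> c p \<noteq> 0}"
    have S: "S \<subseteq> cdom c" using C c by (simp add: partition_of_unity_def S_def)
    have supp: "\<rho> c p = 0" if "p \<in> topspace X" "p \<notin> S" for p
      using closure_of_subset[of "{p \<in> topspace X. \<rho> c p \<noteq> 0}" X] that unfolding S_def by blast
    have \<rho>1: "\<bar>\<rho> c p\<bar> \<le> 1" if "p \<in> topspace X" for p
    proof -
      have "\<rho> c p \<le> (\<Sum>c\<in>C. \<rho> c p)"
        using C c that by (intro member_le_sum) (auto simp: partition_of_unity_def)
      then show ?thesis using C c that by (auto simp: partition_of_unity_def)
    qed
    define K where "K = cmap c ` S"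
    have "compactin X S"
      using closed_oriented unfolding S_def closed_oriented_manifold_def
      by (intro closedin_compact_space closedin_closure_of) auto
    then have "compactin (subtopology X (cdom c)) S"
      using S by (simp add: compactin_subtopology)
    then have "compactin (top_of_set (cimg c)) K"
      unfolding K_def by (rule image_compactin[OF _ homeomorphic_imp_continuous_map[OF cmap_homeomorphic[OF cA]]])
    then have K: "compact K" "K \<subseteq> cimg c"
      by (simp_all add: compactin_subtopology)
    obtain B \<delta> where B: "\<delta> > 0" "B \<ge> 0" "\<And>t x. \<bar>t\<bar> < \<delta> \<Longrightarrow> x \<in> K \<Longrightarrow>
      \<bar>\<theta> t c x (axis 1 1) (axis 2 1) (axis 3 1)\<bar> \<le> B * t\<^sup>2"
      using bound[OF cA K] by blast
    show ?thesis
    proof (rule has_real_derivative_0_quadratic[OF B(1)])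
      fix t assume t: "\<bar>t\<bar> < \<delta>"
      have "\<bar>integral (cimg c) (\<lambda>x. \<rho> c (cinv c x) * \<theta> t c x (axis 1 1) (axis 2 1) (axis 3 1))\<bar>
          \<le> (B * t\<^sup>2) * measure lebesgue K"
      proof (rule integral_bound_compact_support[OF K])
        show "0 \<le> B * t\<^sup>2" using B by simp
      next
        fix x assume x: "x \<in> cimg c - K"
        then have "cinv c x \<notin> S" "cinv c x \<in> topspace X"
          using cdom_subset[OF cA] cinv_in[of x c] unfolding K_def by (force simp: image_iff)+
        then show "\<rho> c (cinv c x) * \<theta> t c x (axis 1 1) (axis 2 1) (axis 3 1) = 0"
          using supp by simp
      next
        fix x assume x: "x \<in> K"
        then have "cinv c x \<in> topspace X" using K cdom_subset[OF cA] cinv_in by blast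
        then have "\<bar>\<rho> c (cinv c x)\<bar> * \<bar>\<theta> t c x (axis 1 1) (axis 2 1) (axis 3 1)\<bar> \<le> 1 * (B * t\<^sup>2)"
          using B(3)[OF t x] \<rho>1 by (intro mult_mono) auto
        then show "\<bar>\<rho> c (cinv c x) * \<theta> t c x (axis 1 1) (axis 2 1) (axis 3 1)\<bar> \<le> B * t\<^sup>2"
          by (simp add: abs_mult)
      qed
      then show "\<bar>integral (cimg c) (\<lambda>x. \<rho> c (cinv c x) * \<theta> t c x (axis 1 1) (axis 2 1) (axis 3 1))\<bar>
          \<le> (B * measure lebesgue K) * t\<^sup>2"
        by (simp add: algebra_simps)
    qed
  qed
  then have "((\<lambda>t. \<Sum>c\<in>C. integral (cimg c)
      (\<lambda>x. \<rho> c (cinv c x) * \<theta> t c x (axis 1 1) (axis 2 1) (axis 3 1))) has_real_derivative (\<Sum>c\<in>C. 0)) (at 0)"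
    by (intro DERIV_sum)
  then show ?thesis unfolding int by simp
qed

end

section \<open>Variations of a pair with vanishing contraction\<close>

lemma smooth_slice_has_derivative:
  assumes "smooth_on (I \<times> U) G" "t \<in> I" "x \<in> U"
  shows "((\<lambda>y. G (t, y)) has_derivative (\<lambda>u. frechet_derivative G (at (t, x)) (0, u))) (at x)"
  by (rule has_derivative_compose[where f = "\<lambda>y. (t, y)", OF _ smooth_on_has_derivative[OF assms(1)]])
    (use assms in \<open>auto intro!: derivative_eq_intros\<close>)

lemma frechet_derivative_slice:
  assumes "smooth_on (I \<times> U) G" "t \<in> I" "x \<in> U"
  shows "frechet_derivative (\<lambda>y. G (t, y)) (at x) u = frechet_derivative G (at (t, x)) (0, u)"
  using frechet_derivative_at[OF smooth_slice_has_derivative[OF assms]] by metis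

text \<open>Mean value theorem in the parameter \<open>t\<close>: the derivative of \<open>G\<close> in this direction is bounded on
  the compact set of all \<open>(t, x)\<close> with \<open>\<bar>t\<bar> \<le> \<epsilon>/2\<close> and \<open>x \<in> K\<close>.\<close>

lemma smooth_family_linear_bound:
  fixes G :: "real \<times> 'b::euclidean_space \<Rightarrow> real"
  assumes G: "smooth_on ({-\<epsilon><..<\<epsilon>} \<times> U) G" and "\<epsilon> > 0"
    and zero: "\<And>x. x \<in> U \<Longrightarrow> G (0, x) = 0" and K: "compact K" "K \<subseteq> U"
  obtains B where "B \<ge> 0" "\<And>t x. \<bar>t\<bar> \<le> \<epsilon> / 2 \<Longrightarrow> x \<in> K \<Longrightarrow> \<bar>G (t, x)\<bar> \<le> B * \<bar>t\<bar>"
proof -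
  define P where "P z = frechet_derivative G (at z) (1, 0)" for z
  let ?J = "{-\<epsilon>/2..\<epsilon>/2}"
  have JK: "?J \<times> K \<subseteq> {-\<epsilon><..<\<epsilon>} \<times> U" using K \<open>\<epsilon> > 0\<close> by auto
  have "continuous_on (?J \<times> K) P"
    using smooth_on_continuous[OF smooth_on_frechet[OF G]] continuous_on_subset[OF _ JK]
    unfolding P_def by blast
  then have "bounded (P ` (?J \<times> K))"
    using K(1) by (intro compact_imp_bounded compact_continuous_image compact_Times compact_Icc)
  then obtain B where B: "B > 0" "\<And>z. z \<in> ?J \<times> K \<Longrightarrow> norm (P z) \<le> B"
    unfolding bounded_pos by auto
  have "\<bar>G (t, x)\<bar> \<le> B * \<bar>t\<bar>" if "\<bar>t\<bar> \<le> \<epsilon> / 2" "x \<in> K" for t x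
  proof -
    have "norm (G (t, x) - G (0, x)) \<le> B * norm (t - 0)"
    proof (rule field_differentiable_bound[where S = ?J and f' = "\<lambda>s. P (s, x)"])
      fix s assume s: "s \<in> ?J"
      have sx: "(s, x) \<in> {-\<epsilon><..<\<epsilon>} \<times> U" using JK s that by blast
      have D: "((\<lambda>s. G (s, x)) has_derivative (\<lambda>h. frechet_derivative G (at (s, x)) (h, 0))) (at s)"
        by (rule has_derivative_compose[where f = "\<lambda>s. (s, x)", OF _ smooth_on_has_derivative[OF G sx]])
          (auto intro!: derivative_eq_intros)
      have eq: "frechet_derivative G (at (s, x)) (h, 0) = P (s, x) * h" for h
        using linear_scale[OF has_derivative_linear[OF smooth_on_has_derivative[OF G sx]], of h "(1, 0)"]
        by (simp add: P_def mult.commute)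
      from D show "((\<lambda>s. G (s, x)) has_field_derivative P (s, x)) (at s within ?J)"
        unfolding has_field_derivative_def eq by (rule has_derivative_at_withinI)
      show "norm (P (s, x)) \<le> B" using B s that by auto
    qed (use that in auto)
    then show ?thesis using zero K that by auto
  qed
  then show ?thesis using B that[of B] by simp
qed

lemma smooth_family_quadratic_bound:
  fixes G H :: "real \<times> 'b::euclidean_space \<Rightarrow> real"
  assumes "smooth_on ({-\<epsilon><..<\<epsilon>} \<times> U) G" "smooth_on ({-\<epsilon><..<\<epsilon>} \<times> U) H" and "\<epsilon> > 0"
    and "\<And>x. x \<in> U \<Longrightarrow> G (0, x) = 0" "\<And>x. x \<in> U \<Longrightarrow> H (0, x) = 0" and "compact K" "K \<subseteq> U"
  obtains B where "B \<ge> 0" "\<And>t x. \<bar>t\<bar> \<le> \<epsilon> / 2 \<Longrightarrow> x \<in> K \<Longrightarrow> \<bar>G (t, x) * H (t, x)\<bar> \<le> B * t\<^sup>2"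
proof -
  obtain B where B: "B \<ge> 0" "\<And>t x. \<bar>t\<bar> \<le> \<epsilon> / 2 \<Longrightarrow> x \<in> K \<Longrightarrow> \<bar>G (t, x)\<bar> \<le> B * \<bar>t\<bar>"
    using smooth_family_linear_bound[of \<epsilon> U G K] assms by metis
  obtain B' where B': "B' \<ge> 0" "\<And>t x. \<bar>t\<bar> \<le> \<epsilon> / 2 \<Longrightarrow> x \<in> K \<Longrightarrow> \<bar>H (t, x)\<bar> \<le> B' * \<bar>t\<bar>"
    using smooth_family_linear_bound[of \<epsilon> U H K] assms by metis
  have "\<bar>G (t, x) * H (t, x)\<bar> \<le> (B * B') * t\<^sup>2" if "\<bar>t\<bar> \<le> \<epsilon> / 2" "x \<in> K" for t x
  proof -
    have "\<bar>G (t, x)\<bar> * \<bar>H (t, x)\<bar> \<le> (B * \<bar>t\<bar>) * (B' * \<bar>t\<bar>)"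
      using B B' that by (intro mult_mono) auto
    also have "\<dots> = (B * B') * \<bar>t\<bar>\<^sup>2" by (simp add: power2_eq_square)
    finally show ?thesis by (simp add: abs_mult)
  qed
  then show ?thesis using that[of "B * B'"] B B' by simp
qed

lemma ext_deriv_cong:
  assumes "open (cimg c)" "x \<in> cimg c" "\<And>y. y \<in> cimg c \<Longrightarrow> \<omega> c y = \<omega>' c y"
  shows "ext_deriv \<omega> c x = ext_deriv \<omega>' c x"
proof -
  have "frechet_derivative (\<lambda>y. \<omega> c y v) (at x) = frechet_derivative (\<lambda>y. \<omega>' c y v) (at x)" for v
    by (rule frechet_derivative_cong_open[OF assms(1,2)]) (simp add: assms(3))
  then show ?thesis by (simp add: ext_deriv_def fun_eq_iff)
qed

text \<open>Differentiating a pairing of a form with a vector means writing it in coordinates first, because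
  smoothness of a form is smoothness of its coefficients.\<close>

lemma linear_axis_sum:
  fixes f :: "real ^ 'n \<Rightarrow> 'b::real_vector"
  assumes "linear f"
  shows "f v = (\<Sum>i\<in>UNIV. v $ i *\<^sub>R f (axis i 1))"
proof -
  have "f (\<Sum>i\<in>UNIV. v $ i *\<^sub>R axis i 1) = (\<Sum>i\<in>UNIV. v $ i *\<^sub>R f (axis i 1))"
    by (simp add: linear_sum[OF assms] linear_scale[OF assms])
  moreover have "(\<Sum>i\<in>UNIV. v $ i *\<^sub>R axis i 1) = v"
    using basis_expansion[of v] by (simp add: scalar_mult_eq_scaleR)
  ultimately show ?thesis by simp
qed

lemma frechet_derivative_pairing:
  fixes W :: "'a::real_normed_vector \<Rightarrow> real ^ 'n \<Rightarrow> real"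
  assumes "open S" "x \<in> S" "\<And>y. y \<in> S \<Longrightarrow> linear (W y)"
    and "\<And>i. ((\<lambda>y. W y (axis i 1)) has_derivative D i) (at x)"
  shows "frechet_derivative (\<lambda>y. W y w) (at x) u = (\<Sum>i\<in>UNIV. w $ i * D i u)"
proof -
  have "((\<lambda>y. \<Sum>i\<in>UNIV. w $ i * W y (axis i 1)) has_derivative (\<lambda>u. \<Sum>i\<in>UNIV. w $ i * D i u)) (at x)"
    by (intro has_derivative_sum has_derivative_mult_right assms(4))
  then have "((\<lambda>y. W y w) has_derivative (\<lambda>u. \<Sum>i\<in>UNIV. w $ i * D i u)) (at x)"
    by (rule has_derivative_transform_within_open[OF _ assms(1,2)])
      (simp only: linear_axis_sum[OF assms(3), of _ w] real_scaleR_def)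
  then show ?thesis by (rule fun_cong[OF frechet_derivative_at[symmetric]])
qed

text \<open>The value on \<open>v\<close> of \<open>\<eta>\<^sub>t\<close>, expressed by derivatives of the coefficients of \<open>\<omega>\<^sub>t\<close> as functions of
  \<open>(t, x)\<close> jointly; the zero in \<open>(0, v)\<close> means that \<open>t\<close> is held fixed. In this form joint smoothness
  is evident.\<close>

definition eta_family :: "(real \<Rightarrow> ('a, 'n::finite) form1) \<Rightarrow> (real \<Rightarrow> ('a, 'n) vfield) \<Rightarrow>
    ('a, 'n) chart \<Rightarrow> real ^ 'n \<Rightarrow> real \<times> (real ^ 'n) \<Rightarrow> real" where
  "eta_family \<omega> V c v z = (\<Sum>i\<in>UNIV. V (fst z) c (snd z) $ i *
     (frechet_derivative (\<lambda>(t, x). \<omega> t c x v) (at z) (0, axis i 1) -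
      frechet_derivative (\<lambda>(t, x). \<omega> t c x (axis i 1)) (at z) (0, v)))"

context closed_oriented_3_manifold
begin

context
  fixes D T \<epsilon> \<omega> V
  assumes var: "variation A D T \<epsilon> \<omega> V" and eps: "\<epsilon> > 0"
begin

private abbreviation "cylinder c \<equiv> {-\<epsilon><..<\<epsilon>} \<times> cimg c"

lemma open_cylinder: "c \<in> A \<Longrightarrow> open (cylinder c)"
  by (intro open_Times open_cimg) auto

lemma variation_smooth:
  "c \<in> A \<Longrightarrow> smooth_on (cylinder c) (\<lambda>(t, x). \<omega> t c x v)"
  "c \<in> A \<Longrightarrow> smooth_on (cylinder c) (\<lambda>(t, x). V t c x)"
  using var by (auto simp: variation_def)

lemma smooth_eta_family:
  assumes c: "c \<in> A"
  shows "smooth_on (cylinder c) (eta_family \<omega> V c v)"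
proof -
  have "smooth_on (cylinder c) (\<lambda>z. V (fst z) c (snd z))"
    using variation_smooth(2)[OF c] by (simp add: case_prod_unfold)
  then have "smooth_on (cylinder c) (\<lambda>z. V (fst z) c (snd z) \<bullet> axis i 1)" for i
    by (intro smooth_on_inner open_cylinder c smooth_on_const)
  then have "smooth_on (cylinder c) (\<lambda>z. V (fst z) c (snd z) $ i)" for i
    by (simp add: inner_axis)
  then show ?thesis
    unfolding eta_family_def[abs_def]
    by (intro smooth_on_sum smooth_on_mult smooth_on_diff smooth_on_frechet open_cylinder c variation_smooth)
qed

lemma variation_defining_form:
  assumes "c \<in> A" "x \<in> cimg c" "\<bar>t\<bar> < \<epsilon>"
  shows "defining_form (kernel_field (\<omega> t)) (V t) c x = \<omega> t c x" "linear (\<omega> t c x)"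
proof -
  show l: "linear (\<omega> t c x)"
    using var assms by (auto simp: variation_def one_form_def)
  show "defining_form (kernel_field (\<omega> t)) (V t) c x = \<omega> t c x"
    using var assms by (intro defining_form_eqI l) (auto simp: kernel_field_def variation_def)
qed

lemma contract_variation:
  assumes c: "c \<in> A" and x: "x \<in> cimg c" and t: "\<bar>t\<bar> < \<epsilon>"
  shows "contract (V t) (ext_deriv (defining_form (kernel_field (\<omega> t)) (V t))) c x v = eta_family \<omega> V c v (t, x)"
proof -
  let ?D = "\<lambda>v. frechet_derivative (\<lambda>(t, x). \<omega> t c x v) (at (t, x))"
  have tx: "t \<in> {-\<epsilon><..<\<epsilon>}" using t by auto
  have slice: "((\<lambda>y. \<omega> t c y v) has_derivative (\<lambda>u. ?D v (0, u))) (at x)" for v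
    using smooth_slice_has_derivative[OF variation_smooth(1)[OF c] tx x] by simp
  have "frechet_derivative (\<lambda>y. \<omega> t c y (V t c x)) (at x) v = (\<Sum>i\<in>UNIV. V t c x $ i * ?D (axis i 1) (0, v))"
    by (rule frechet_derivative_pairing[OF open_cimg[OF c] x variation_defining_form(2)[OF c _ t] slice])
  moreover have "frechet_derivative (\<lambda>y. \<omega> t c y v) (at x) (V t c x) = (\<Sum>i\<in>UNIV. V t c x $ i * ?D v (0, axis i 1))"
    using linear_axis_sum[OF has_derivative_linear[OF slice], of v "V t c x"]
      frechet_derivative_at[OF slice, of v, symmetric] by simp
  moreover have "ext_deriv (defining_form (kernel_field (\<omega> t)) (V t)) c x = ext_deriv (\<omega> t) c x"
    using variation_defining_form(1)[OF c _ t] by (intro ext_deriv_cong open_cimg c x)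
  ultimately show ?thesis
    by (simp add: contract_def ext_deriv_def eta_family_def right_diff_distrib sum_subtractf)
qed

lemma ext_deriv_contract_variation:
  assumes c: "c \<in> A" and x: "x \<in> cimg c" and t: "\<bar>t\<bar> < \<epsilon>"
  shows "ext_deriv (contract (V t) (ext_deriv (defining_form (kernel_field (\<omega> t)) (V t)))) c x u w =
    frechet_derivative (eta_family \<omega> V c w) (at (t, x)) (0, u) -
    frechet_derivative (eta_family \<omega> V c u) (at (t, x)) (0, w)"
proof -
  have tx: "t \<in> {-\<epsilon><..<\<epsilon>}" using t by auto
  have "frechet_derivative (\<lambda>y. contract (V t) (ext_deriv (defining_form (kernel_field (\<omega> t)) (V t))) c y v) (at x) =
      frechet_derivative (\<lambda>y. eta_family \<omega> V c v (t, y)) (at x)" for v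
    by (rule frechet_derivative_cong_open[OF open_cimg[OF c] x contract_variation[OF c _ t]])
  then show ?thesis
    unfolding ext_deriv_def by (simp add: frechet_derivative_slice[OF smooth_eta_family[OF c] tx x])
qed

text \<open>All coefficients of \<open>\<eta>\<^sub>t\<close> and \<open>d\<eta>\<^sub>t\<close> are smooth in \<open>(t, x)\<close> and vanish at \<open>t = 0\<close>, hence are \<open>O(t)\<close>
  on compact sets, and \<open>\<eta>\<^sub>t \<and> d\<eta>\<^sub>t\<close> is a sum of three products of them.\<close>

lemma variation_derivative_zero:
  assumes zero: "\<And>c x v. c \<in> A \<Longrightarrow> x \<in> cimg c \<Longrightarrow> contract T (ext_deriv (defining_form D T)) c x v = 0"
  shows "((\<lambda>t. gv X A Or (kernel_field (\<omega> t)) (V t)) has_real_derivative 0) (at 0)"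
  unfolding gv_def Let_def
proof (rule form_integral_quadratic)
  fix c and K :: "(real ^ 3) set"
  assume c: "c \<in> A" and K: "compact K" "K \<subseteq> cimg c"
  \<comment> \<open>\<open>E\<close> and \<open>F\<close> are the coefficients of \<open>\<eta>\<^sub>t\<close> and \<open>d\<eta>\<^sub>t\<close>.\<close>
  define E where "E v = eta_family \<omega> V c v" for v
  define F where "F u w z = frechet_derivative (E w) (at z) (0, u) - frechet_derivative (E u) (at z) (0, w)" for u w z
  have E: "smooth_on (cylinder c) (E v)" for v
    unfolding E_def by (rule smooth_eta_family[OF c])
  have F: "smooth_on (cylinder c) (F u w)" for u w
    unfolding F_def[abs_def] by (intro smooth_on_diff open_cylinder c smooth_on_frechet E)
  have 0: "0 \<in> {-\<epsilon><..<\<epsilon>}" "\<bar>0\<bar> < \<epsilon>" using eps by auto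
  have E0: "E v (0, x) = 0" if x: "x \<in> cimg c" for v x
  proof -
    have "ext_deriv (defining_form (kernel_field (\<omega> 0)) (V 0)) c x = ext_deriv (defining_form D T) c x"
    proof (rule ext_deriv_cong[OF open_cimg[OF c] x])
      fix y assume "y \<in> cimg c"
      then show "defining_form (kernel_field (\<omega> 0)) (V 0) c y = defining_form D T c y"
        using variation_defining_form(1)[OF c _ 0(2)] var c by (simp add: variation_def)
    qed
    moreover have "V 0 c x = T c x" using var c x by (simp add: variation_def)
    ultimately show ?thesis
      unfolding E_def contract_variation[OF c x 0(2), symmetric]
      using zero[OF c x] by (simp add: contract_def)
  qed
  have F0: "F u w (0, x) = 0" if x: "x \<in> cimg c" for u w x
  proof -
    have "frechet_derivative (E v) (at (0, x)) (0, u) = frechet_derivative (\<lambda>y. E v (0, y)) (at x) u" for u v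
      by (rule frechet_derivative_slice[OF E 0(1) x, symmetric])
    moreover have "frechet_derivative (\<lambda>y. E v (0, y)) (at x) = frechet_derivative (\<lambda>y. 0) (at x)" for v
      by (rule frechet_derivative_cong_open[OF open_cimg[OF c] x E0])
    ultimately show ?thesis by (simp add: F_def)
  qed
  define bd where "bd u v w B \<longleftrightarrow>
    B \<ge> 0 \<and> (\<forall>t x. \<bar>t\<bar> \<le> \<epsilon> / 2 \<longrightarrow> x \<in> K \<longrightarrow> \<bar>E v (t, x) * F u w (t, x)\<bar> \<le> B * t\<^sup>2)" for u v w B
  define B where "B u v w = (SOME B. bd u v w B)" for u v w
  have "\<exists>B. bd u v w B" for u v w
    unfolding bd_def using smooth_family_quadratic_bound[OF E F eps E0 F0 K] by metis
  then have "bd u v w (B u v w)" for u v w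
    unfolding B_def by (rule someI_ex)
  then have B: "B u v w \<ge> 0"
    "\<bar>t\<bar> \<le> \<epsilon> / 2 \<Longrightarrow> x \<in> K \<Longrightarrow> \<bar>E v (t, x) * F u w (t, x)\<bar> \<le> B u v w * t\<^sup>2" for u v w t x
    by (simp_all add: bd_def)
  let ?e = "\<lambda>i. axis i 1 :: real ^ 3"
  let ?B = "B (?e 2) (?e 1) (?e 3) + B (?e 1) (?e 2) (?e 3) + B (?e 1) (?e 3) (?e 2)"
  let ?\<eta> = "\<lambda>t. contract (V t) (ext_deriv (defining_form (kernel_field (\<omega> t)) (V t)))"
  have "\<bar>wedge12 (?\<eta> t) (ext_deriv (?\<eta> t)) c x (?e 1) (?e 2) (?e 3)\<bar> \<le> ?B * t\<^sup>2" if t: "\<bar>t\<bar> < \<epsilon> / 2" and x: "x \<in> K" for t x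
  proof -
    have x': "x \<in> cimg c" and t': "\<bar>t\<bar> < \<epsilon>" using K t x by auto
    have eq: "wedge12 (?\<eta> t) (ext_deriv (?\<eta> t)) c x (?e 1) (?e 2) (?e 3) =
        E (?e 1) (t, x) * F (?e 2) (?e 3) (t, x) - E (?e 2) (t, x) * F (?e 1) (?e 3) (t, x)
        + E (?e 3) (t, x) * F (?e 1) (?e 2) (t, x)"
      unfolding wedge12_def contract_variation[OF c x' t'] ext_deriv_contract_variation[OF c x' t']
      by (simp add: E_def F_def)
    show ?thesis
      unfolding eq distrib_right
      using B(2)[of t x "?e 1" "?e 2" "?e 3"] B(2)[of t x "?e 2" "?e 1" "?e 3"] B(2)[of t x "?e 3" "?e 1" "?e 2"] t x
      by linarith
  qed
  then show "\<exists>B \<delta>. \<delta> > 0 \<and> B \<ge> 0 \<and> (\<forall>t x. \<bar>t\<bar> < \<delta> \<longrightarrow> x \<in> K \<longrightarrow>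
      \<bar>wedge12 (?\<eta> t) (ext_deriv (?\<eta> t)) c x (?e 1) (?e 2) (?e 3)\<bar> \<le> B * t\<^sup>2)"
    using eps B(1) by (intro exI[of _ ?B] exI[of _ "\<epsilon> / 2"]) auto
qed

end

lemma contract_zero_imp_critical:
  assumes zero: "\<And>c x v. c \<in> A \<Longrightarrow> x \<in> cimg c \<Longrightarrow> contract T (ext_deriv (defining_form D T)) c x v = 0"
  shows "critical X A Or D T"
  unfolding critical_def using variation_derivative_zero[OF _ _ zero] by blast

lemma contract_zero_imp_gv_zero:
  assumes zero: "\<And>c x v. c \<in> A \<Longrightarrow> x \<in> cimg c \<Longrightarrow> contract T (ext_deriv (defining_form D T)) c x v = 0"
  shows "gv X A Or D T = 0"
  unfolding gv_def Let_def
  by (rule form_integral_zero) (simp add: wedge12_def zero)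

end

section \<open>Unit geodesic fields\<close>

text \<open>Product rule for the pairing of a form with a vector field: the first summand differentiates the
  form with the vector frozen, the second one differentiates the vector.\<close>

lemma has_derivative_pairing:
  fixes W :: "'a::real_normed_vector \<Rightarrow> real ^ 'n \<Rightarrow> real"
  assumes S: "open S" "x \<in> S" and W: "\<And>y. y \<in> S \<Longrightarrow> linear (W y)" "\<And>v. smooth_on S (\<lambda>y. W y v)"
    and U: "(U has_derivative U') (at x)"
  shows "((\<lambda>y. W y (U y)) has_derivative
    (\<lambda>u. frechet_derivative (\<lambda>y. W y (U x)) (at x) u + W x (U' u))) (at x)"
proof -
  let ?D = "\<lambda>i. frechet_derivative (\<lambda>y. W y (axis i 1)) (at x)"
  have D: "((\<lambda>y. W y (axis i 1)) has_derivative ?D i) (at x)" for i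
    by (rule smooth_on_has_derivative[OF W(2) S(2)])
  have "((\<lambda>y. U y $ i) has_derivative (\<lambda>u. U' u $ i)) (at x)" for i
    by (rule bounded_linear.has_derivative[OF bounded_linear_vec_nth U])
  then have "((\<lambda>y. \<Sum>i\<in>UNIV. U y $ i * W y (axis i 1)) has_derivative
      (\<lambda>u. \<Sum>i\<in>UNIV. U x $ i * ?D i u + U' u $ i * W x (axis i 1))) (at x)"
    by (intro has_derivative_sum has_derivative_mult D)
  moreover have "(\<Sum>i\<in>UNIV. U x $ i * ?D i u + U' u $ i * W x (axis i 1)) =
      frechet_derivative (\<lambda>y. W y (U x)) (at x) u + W x (U' u)" for u
    using linear_axis_sum[OF W(1)[OF S(2)], of "U' u"]
    by (simp only: sum.distrib frechet_derivative_pairing[OF S W(1) D, of "U x" u] real_scaleR_def)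
  ultimately have "((\<lambda>y. \<Sum>i\<in>UNIV. U y $ i * W y (axis i 1)) has_derivative
      (\<lambda>u. frechet_derivative (\<lambda>y. W y (U x)) (at x) u + W x (U' u))) (at x)"
    by (simp only:)
  then show ?thesis
  proof (rule has_derivative_transform_within_open[OF _ S])
    fix y assume "y \<in> S"
    then show "(\<Sum>i\<in>UNIV. U y $ i * W y (axis i 1)) = W y (U y)"
      by (simp only: linear_axis_sum[OF W(1), of y "U y"] real_scaleR_def)
  qed
qed

lemma smooth_pairing:
  fixes W :: "'a::real_normed_vector \<Rightarrow> real ^ 'n \<Rightarrow> real"
  assumes S: "open S" and W: "\<And>y. y \<in> S \<Longrightarrow> linear (W y)" "\<And>v. smooth_on S (\<lambda>y. W y v)"
    and U: "smooth_on S U"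
  shows "smooth_on S (\<lambda>y. W y (U y))"
proof -
  have "smooth_on S (\<lambda>y. U y \<bullet> axis i 1)" for i
    by (intro smooth_on_inner S U smooth_on_const)
  then have "smooth_on S (\<lambda>y. U y $ i)" for i
    by (simp add: inner_axis)
  then have "smooth_on S (\<lambda>y. \<Sum>i\<in>UNIV. U y $ i * W y (axis i 1))"
    by (intro smooth_on_sum smooth_on_mult S W)
  moreover have "smooth_on S (\<lambda>y. \<Sum>i\<in>UNIV. U y $ i * W y (axis i 1)) = smooth_on S (\<lambda>y. W y (U y))"
  proof (rule smooth_on_cong[OF S])
    fix y assume "y \<in> S"
    then show "(\<Sum>i\<in>UNIV. U y $ i * W y (axis i 1)) = W y (U y)"
      by (simp only: linear_axis_sum[OF W(1), of y "U y"] real_scaleR_def)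
  qed
  ultimately show ?thesis by simp
qed

text \<open>The Cartan formula. In \<open>ext_deriv\<close> the arguments of the form are constant vectors; letting them
  vary as \<open>V\<close> and \<open>W\<close> produces by the product rule two extra terms, which make up the Lie bracket.\<close>

lemma ext_deriv_lie_bracket:
  assumes c: "open (cimg c)" "x \<in> cimg c"
    and \<omega>: "\<And>y. y \<in> cimg c \<Longrightarrow> linear (\<omega> c y)" "\<And>v. smooth_on (cimg c) (\<lambda>y. \<omega> c y v)"
    and V: "smooth_on (cimg c) (V c)" and W: "smooth_on (cimg c) (W c)"
  shows "ext_deriv \<omega> c x (V c x) (W c x) =
    frechet_derivative (\<lambda>y. \<omega> c y (W c y)) (at x) (V c x)
    - frechet_derivative (\<lambda>y. \<omega> c y (V c y)) (at x) (W c x) - \<omega> c x (lie_bracket V W c x)"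
proof -
  have "frechet_derivative (\<lambda>y. \<omega> c y (U c y)) (at x) u =
      frechet_derivative (\<lambda>y. \<omega> c y (U c x)) (at x) u + \<omega> c x (frechet_derivative (U c) (at x) u)"
    if "smooth_on (cimg c) (U c)" for U u
    using frechet_derivative_at[OF has_derivative_pairing[OF c \<omega> smooth_on_has_derivative[OF that c(2)]], symmetric]
    by (rule fun_cong)
  then show ?thesis
    by (simp add: V W ext_deriv_def lie_bracket_def linear_diff[OF \<omega>(1)[OF c(2)]])
qed

context smooth_atlas
begin

lemma geodesic_contract_zero:
  assumes g: "riemannian_metric A g" and lc: "levi_civita A g nabla" and T: "vector_field A T"
    and unit: "unit_field A g T" and geo: "vf_eq A (nabla T T) (\<lambda>c x. 0)"
    and c: "c \<in> A" and x: "x \<in> cimg c"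
  shows "contract T (ext_deriv (defining_form (orthogonal_field g T) T)) c x v = 0"
proof -
  \<comment> \<open>The axioms of a connection speak of global fields, so \<open>v\<close> is extended to one.\<close>
  obtain W where W: "vector_field A W" "W c x = v"
    by (rule vector_field_extension[OF c x])
  have lin: "linear (g c y u)" and sym: "g c y u w = g c y w u" if "y \<in> cimg c" for y u w
    using g c that by (auto simp: riemannian_metric_def)
  have smooth_g: "smooth_on (cimg c) (\<lambda>y. g c y u w)" for u w
    using g c by (auto simp: riemannian_metric_def)
  have unit': "g c y (T c y) (T c y) = 1" if "y \<in> cimg c" for y
    using unit c that by (auto simp: unit_field_def)
  have TW: "smooth_on (cimg c) (T c)" "smooth_on (cimg c) (W c)"
    using T W c by (auto simp: vector_field_def)
  define \<alpha> where "\<alpha> c y u = g c y (T c y) u" for c y u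
  have \<alpha>_lin: "linear (\<alpha> c y)" if "y \<in> cimg c" for y
    using lin[OF that] unfolding \<alpha>_def[abs_def] by simp
  have \<alpha>_eq: "defining_form (orthogonal_field g T) T c y = \<alpha> c y" if y: "y \<in> cimg c" for y
    using \<alpha>_lin[OF y] unit'[OF y] sym[OF y]
    by (intro defining_form_eqI) (auto simp: \<alpha>_def orthogonal_field_def)
  have \<alpha>_smooth: "smooth_on (cimg c) (\<lambda>y. \<alpha> c y u)" for u
  proof -
    have "smooth_on (cimg c) (\<lambda>y. g c y u (T c y))"
      by (rule smooth_pairing[OF open_cimg[OF c] lin smooth_g TW(1)])
    moreover have "smooth_on (cimg c) (\<lambda>y. g c y u (T c y)) = smooth_on (cimg c) (\<lambda>y. \<alpha> c y u)"
      by (rule smooth_on_cong[OF open_cimg[OF c]]) (simp add: \<alpha>_def sym)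
    ultimately show ?thesis by simp
  qed
  have nabla: "frechet_derivative (\<lambda>y. g c y (V c y) (W c y)) (at x) (U c x) =
      g c x (nabla U V c x) (W c x) + g c x (V c x) (nabla U W c x)"
    if "vector_field A U" "vector_field A V" "vector_field A W" for U V W
    using lc c x that unfolding levi_civita_def by blast
  have torsion: "lie_bracket T W c x = nabla T W c x - nabla W T c x"
    using lc c x T W(1) unfolding levi_civita_def vf_eq_def by metis
  have "frechet_derivative (\<lambda>y. g c y (T c y) (T c y)) (at x) = frechet_derivative (\<lambda>y. 1) (at x)"
    by (rule frechet_derivative_cong_open[OF open_cimg[OF c] x unit'])
  then have const: "frechet_derivative (\<lambda>y. g c y (T c y) (T c y)) (at x) u = 0" for u
    by simp
  have TWT: "g c x (T c x) (nabla W T c x) = 0"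
    using nabla[OF W(1) T T] const sym[OF x, of "T c x" "nabla W T c x"] by simp
  have TTW: "g c x (nabla T T c x) (W c x) = 0"
    using geo c x sym[OF x, of 0] linear_0[OF lin[OF x]] by (auto simp: vf_eq_def)
  have "ext_deriv \<alpha> c x (T c x) (W c x) =
      frechet_derivative (\<lambda>y. \<alpha> c y (W c y)) (at x) (T c x)
      - frechet_derivative (\<lambda>y. \<alpha> c y (T c y)) (at x) (W c x) - \<alpha> c x (lie_bracket T W c x)"
    using \<alpha>_lin \<alpha>_smooth by (intro ext_deriv_lie_bracket open_cimg c x TW)
  also have "\<dots> = 0"
    using nabla[OF T T W(1)] const TWT TTW by (simp add: \<alpha>_def torsion linear_diff[OF lin[OF x]])
  finally show ?thesis
    using ext_deriv_cong[where \<omega> = "defining_form (orthogonal_field g T) T" and \<omega>' = \<alpha>, OF open_cimg[OF c] x \<alpha>_eq] W(2)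
    by (simp add: contract_def)
qed

end

section \<open>Riemannian foliations\<close>

text \<open>Along the line through \<open>x\<close> in a direction \<open>w\<close> without third component, \<open>\<phi>\<close> is locally constant.\<close>

lemma derivative_zero_along_levels:
  fixes \<phi> :: "real ^ 3 \<Rightarrow> real"
  assumes \<phi>: "(\<phi> has_derivative \<phi>') (at x)" and N: "open N" "x \<in> N"
    and h: "\<And>y. y \<in> N \<Longrightarrow> \<phi> y = h (y $ 3)" and w: "w $ 3 = 0"
  shows "\<phi>' w = 0"
proof -
  let ?l = "\<lambda>s. x + s *\<^sub>R w"
  have 1: "((\<lambda>s. \<phi> (?l s)) has_derivative (\<lambda>s. \<phi>' (s *\<^sub>R w))) (at 0)"
    by (rule has_derivative_compose[where f = ?l]) (use \<phi> in \<open>auto intro!: derivative_eq_intros\<close>)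
  have "open (?l -` N)"
    by (rule open_vimage[OF N(1)]) (intro continuous_intros)
  then have "((\<lambda>s. h (x $ 3)) has_derivative (\<lambda>s. \<phi>' (s *\<^sub>R w))) (at 0)"
    by (rule has_derivative_transform_within_open[OF 1]) (use N h w in auto)
  then have "(\<lambda>s. \<phi>' (s *\<^sub>R w)) = (\<lambda>s. 0)"
    using has_derivative_unique has_derivative_const by blast
  then show ?thesis by (metis scaleR_one)
qed

locale foliated_atlas =
  smooth_atlas X A for X :: "'a topology" and A :: "('a, 3) chart set" +
  fixes F :: "('a, 3) chart set"
  assumes foliation: "transversely_oriented_foliation X A F"
begin

lemma F_subset: "F \<subseteq> A"
  using foliation by (simp add: transversely_oriented_foliation_def)

text \<open>Changes of foliated charts map leaves to leaves, infinitesimally.\<close>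

lemma jac_foliated_levels:
  assumes f: "f \<in> F" "f' \<in> F" and x: "x \<in> overlap f f'" and w: "w $ 3 = 0"
  shows "jac f f' x w $ 3 = 0"
proof -
  obtain N h where N: "open N" "x \<in> N" "\<And>y. y \<in> N \<Longrightarrow> transition f f' y $ 3 = h (y $ 3)"
    using foliation f x unfolding transversely_oriented_foliation_def by metis
  have "(transition f f' has_derivative jac f f' x) (at x)"
    using f F_subset x by (intro transition_has_derivative) auto
  from bounded_linear.has_derivative[OF bounded_linear_vec_nth this]
  show ?thesis using N w by (rule derivative_zero_along_levels)
qed

text \<open>The tangent plane of a foliation is described with some foliated chart around the point; by
  \<open>jac_foliated_levels\<close> any other one gives the same plane.\<close>

lemma tangent_field_iff:
  assumes c: "c \<in> A" and f: "f \<in> F" and x: "x \<in> overlap c f"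
  shows "v \<in> tangent_field F c x \<longleftrightarrow> jac c f x v $ 3 = 0"
proof
  assume "v \<in> tangent_field F c x"
  then obtain f' where f': "f' \<in> F" "x \<in> overlap c f'" "jac c f' x v $ 3 = 0"
    by (auto simp: tangent_field_def)
  have A: "f \<in> A" "f' \<in> A" using f f' F_subset by auto
  have "transition c f' x \<in> overlap f' f"
    using A c x f'(2) by (simp add: overlap_iff transition_def)
  then show "jac c f x v $ 3 = 0"
    using jac_chain[OF c A(2,1) f'(2) x] jac_foliated_levels[OF f'(1) f _ f'(3)] by simp
next
  assume "jac c f x v $ 3 = 0"
  then show "v \<in> tangent_field F c x" using f x by (auto simp: tangent_field_def)
qed

context
  fixes g T
  assumes metric: "riemannian_metric A g" and bundle_like: "bundle_like g F" and normal: "unit_normal A g F T"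
begin

text \<open>For \<open>v = T\<close> the bundle-like condition reads \<open>1 = h(y) T\<^sub>3\<^sup>2\<close>; since \<open>T\<^sub>3\<close> is positive, it is determined
  by \<open>h(y)\<close>.\<close>

lemma unit_normal_third_component:
  assumes f: "f \<in> F" and y: "y \<in> cimg f"
  shows "T f y $ 3 > 0"
    and "\<exists>N h. open N \<and> y \<in> N \<and> N \<subseteq> cimg f \<and> (\<forall>z\<in>N. inverse (T f z $ 3) = h (z $ 3))"
proof -
  have fA: "f \<in> A" using f F_subset by blast
  have pos: "T f z $ 3 > 0" if "z \<in> cimg f" for z
    using normal f that by (simp add: unit_normal_def)
  then show "T f y $ 3 > 0" using y by blast
  obtain N h where N: "open N" "y \<in> N" "N \<subseteq> cimg f"
    and h: "\<And>z v. z \<in> N \<Longrightarrow> (\<And>w. w $ 3 = 0 \<Longrightarrow> g f z v w = 0) \<Longrightarrow> g f z v v = h (z $ 3) * (v $ 3)\<^sup>2"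
    using bundle_like f y unfolding bundle_like_def by metis
  have "inverse (T f z $ 3) = inverse (sqrt (1 / h (z $ 3)))" if z: "z \<in> N" for z
  proof -
    have zf: "z \<in> cimg f" using z N by blast
    have "g f z (T f z) w = 0" if "w $ 3 = 0" for w
    proof -
      have "w \<in> tangent_field F f z"
        using that zf by (simp add: tangent_field_iff[OF fA f] overlap_self jac_self[OF fA zf])
      then have "g f z w (T f z) = 0"
        using normal fA zf by (simp add: unit_normal_def)
      then show ?thesis
        using metric fA zf by (auto simp: riemannian_metric_def)
    qed
    then have "g f z (T f z) (T f z) = h (z $ 3) * (T f z $ 3)\<^sup>2"
      using h[OF z] by blast
    moreover have "g f z (T f z) (T f z) = 1"
      using normal fA zf by (simp add: unit_normal_def unit_field_def)
    ultimately have "h (z $ 3) * (T f z $ 3)\<^sup>2 = 1" by simp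
    then have "1 / h (z $ 3) = (T f z $ 3)\<^sup>2"
      by (metis nonzero_eq_divide_eq mult.commute mult_zero_left zero_neq_one)
    then show ?thesis using pos[OF zf] by simp
  qed
  then show "\<exists>N h. open N \<and> y \<in> N \<and> N \<subseteq> cimg f \<and> (\<forall>z\<in>N. inverse (T f z $ 3) = h (z $ 3))"
    using N by (intro exI[of _ N] exI[of _ "\<lambda>r. inverse (sqrt (1 / h r))"]) simp
qed

lemma defining_form_foliation:
  assumes c: "c \<in> A" and f: "f \<in> F" and x: "x \<in> overlap c f"
  shows "defining_form (tangent_field F) T c x =
    (\<lambda>v. inverse (T f (transition c f x) $ 3) * jac c f x v $ 3)"
proof (rule defining_form_eqI)
  have fA: "f \<in> A" using f F_subset by blast
  have pos: "T f (transition c f x) $ 3 > 0"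
    using unit_normal_third_component(1)[OF f transition_cimg[OF c fA x]] .
  have "linear (\<lambda>v. jac c f x v $ 3)"
    using linear_compose[OF linear_jac[OF c fA x] bounded_linear.linear[OF bounded_linear_vec_nth]]
    by (simp add: o_def)
  then show "linear (\<lambda>v. inverse (T f (transition c f x) $ 3) * jac c f x v $ 3)"
    using linear_compose_scale_right[of "\<lambda>v. jac c f x v $ 3"] by simp
  show "{v. inverse (T f (transition c f x) $ 3) * jac c f x v $ 3 = 0} = tangent_field F c x"
    using pos tangent_field_iff[OF c f x] by auto
  have "T f (transition c f x) = jac c f x (T c x)"
    using normal c fA x by (auto simp: unit_normal_def vector_field_def)
  then show "inverse (T f (transition c f x) $ 3) * jac c f x (T c x) $ 3 = 1"
    using pos by simp
qed

text \<open>Here \<open>\<omega> = \<psi> ds\<close>, where \<open>s\<close> is the transverse coordinate pulled back to the chart \<open>c\<close> and \<open>\<psi> = 1/T\<^sub>3\<close>.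
  Thus \<open>d\<omega> = d\<psi> \<and> ds + \<psi> dds\<close>. The first term vanishes since \<open>\<psi>\<close> is locally a function of \<open>s\<close>, so
  that \<open>d\<psi>\<close> is a multiple of \<open>ds\<close>; the second one by the symmetry of the second derivative of \<open>s\<close>.\<close>

lemma foliation_ext_deriv_zero:
  assumes c: "c \<in> A" and x: "x \<in> cimg c"
  shows "ext_deriv (defining_form (tangent_field F) T) c x u v = 0"
proof -
  have "cinv c x \<in> topspace X"
    using cdom_subset[OF c] cinv_in[OF x] by blast
  then have "cinv c x \<in> (\<Union>f\<in>F. cdom f)"
    using foliation by (simp add: transversely_oriented_foliation_def)
  then obtain f where f: "f \<in> F" "cinv c x \<in> cdom f" by (rule UN_E)
  have fA: "f \<in> A" using f F_subset by blast
  have xf: "x \<in> overlap c f" using x f c by (simp add: overlap_iff)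
  have ov: "open (overlap c f)" by (rule open_overlap[OF c fA])
  let ?y = "transition c f x"
  have y: "?y \<in> cimg f" by (rule transition_cimg[OF c fA xf])
  define s where "s z = transition c f z $ 3" for z
  define \<kappa> where "\<kappa> z = inverse (T f z $ 3)" for z
  define \<psi> where "\<psi> z = \<kappa> (transition c f z)" for z
  have jac_s: "jac c f z w $ 3 = frechet_derivative s (at z) w" if "z \<in> overlap c f" for z w
    using frechet_derivative_at[OF bounded_linear.has_derivative[OF bounded_linear_vec_nth
          transition_has_derivative[OF c fA that]], of 3]
    unfolding s_def[abs_def] by metis
  have s: "smooth_on (overlap c f) s"
  proof -
    have "smooth_on (overlap c f) (\<lambda>z. transition c f z \<bullet> axis 3 1)"
      by (intro smooth_on_inner ov smooth_transition c fA smooth_on_const)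
    then show ?thesis by (simp add: s_def[abs_def] inner_axis)
  qed
  have "smooth_on (cimg f) (\<lambda>z. T f z \<bullet> axis 3 1)"
    using normal fA
    by (intro smooth_on_inner open_cimg smooth_on_const) (auto simp: unit_normal_def vector_field_def)
  then have "smooth_on (cimg f) (\<lambda>z. T f z $ 3)" by (simp add: inner_axis)
  then have "smooth_on (cimg f) \<kappa>"
    unfolding \<kappa>_def[abs_def] using unit_normal_third_component(1)[OF f(1)]
    by (intro smooth_on_inverse open_cimg fA) (auto, metis less_irrefl)
  then have \<kappa>: "(\<kappa> has_derivative frechet_derivative \<kappa> (at ?y)) (at ?y)"
    using y by (rule smooth_on_has_derivative)
  let ?\<kappa>' = "frechet_derivative \<kappa> (at ?y)"
  obtain N h where N: "open N" "?y \<in> N" "\<And>z. z \<in> N \<Longrightarrow> \<kappa> z = h (z $ 3)"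
    using unit_normal_third_component(2)[OF f(1) y] unfolding \<kappa>_def by metis
  have \<kappa>'_transverse: "?\<kappa>' w = w $ 3 * ?\<kappa>' (axis 3 1)" for w
  proof -
    have lin: "linear ?\<kappa>'" using \<kappa> by (rule has_derivative_linear)
    have "?\<kappa>' (w - w $ 3 *\<^sub>R axis 3 1) = 0"
      by (rule derivative_zero_along_levels[OF \<kappa> N]) (auto simp: axis_def)
    then show ?thesis by (simp add: linear_diff[OF lin] linear_scale[OF lin])
  qed
  have \<psi>: "(\<psi> has_derivative (\<lambda>w. ?\<kappa>' (jac c f x w))) (at x)"
    unfolding \<psi>_def[abs_def] by (rule has_derivative_compose[OF transition_has_derivative[OF c fA xf] \<kappa>])
  let ?s' = "\<lambda>z. frechet_derivative s (at z)"
  let ?\<omega> = "defining_form (tangent_field F) T"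
  have D: "frechet_derivative (\<lambda>z. ?\<omega> c z w) (at x) w' =
      \<psi> x * frechet_derivative (\<lambda>z. ?s' z w) (at x) w' + (?s' x w' * ?\<kappa>' (axis 3 1)) * ?s' x w" for w w'
  proof -
    have "((\<lambda>z. \<psi> z * ?s' z w) has_derivative
        (\<lambda>w'. \<psi> x * frechet_derivative (\<lambda>z. ?s' z w) (at x) w' + ?\<kappa>' (jac c f x w') * ?s' x w)) (at x)"
      by (rule has_derivative_mult[OF \<psi> smooth_on_has_derivative[OF smooth_on_frechet[OF s] xf]])
    then have "frechet_derivative (\<lambda>z. \<psi> z * ?s' z w) (at x) w' =
        \<psi> x * frechet_derivative (\<lambda>z. ?s' z w) (at x) w' + ?\<kappa>' (jac c f x w') * ?s' x w"
      by (rule fun_cong[OF frechet_derivative_at[symmetric]])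
    moreover have "frechet_derivative (\<lambda>z. ?\<omega> c z w) (at x) = frechet_derivative (\<lambda>z. \<psi> z * ?s' z w) (at x)"
      by (rule frechet_derivative_cong_open[OF ov xf])
        (simp add: defining_form_foliation[OF c f(1)] \<psi>_def \<kappa>_def jac_s)
    ultimately show ?thesis
      using \<kappa>'_transverse[of "jac c f x w'"] jac_s[OF xf] by simp
  qed
  show ?thesis
    unfolding ext_deriv_def D smooth_on_second_derivative_symmetric[OF ov s xf, of u v]
    by (simp add: algebra_simps)
qed

end
end

section \<open>Critical pairs\<close>

theorem proposition4:
  fixes X :: "'a topology" and A Or :: "('a, 3) chart set"
  assumes "closed_oriented_manifold X A Or"
  shows "(\<forall>g nabla T. riemannian_metric A g \<and> levi_civita A g nabla \<and>
            vector_field A T \<and> unit_field A g T \<and> vf_eq A (nabla T T) (\<lambda>c x. 0) \<longrightarrow>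
            critical X A Or (orthogonal_field g T) T \<and>
            gv X A Or (orthogonal_field g T) T = 0) \<and>
         (\<forall>g F T. riemannian_metric A g \<and> transversely_oriented_foliation X A F \<and>
            bundle_like g F \<and> unit_normal A g F T \<longrightarrow>
            critical X A Or (tangent_field F) T)"
proof -
  interpret closed_oriented_3_manifold X A Or
    using assms by unfold_locales
  show ?thesis
  proof (intro conjI allI impI)
    fix g nabla T
    assume *: "riemannian_metric A g \<and> levi_civita A g nabla \<and>
      vector_field A T \<and> unit_field A g T \<and> vf_eq A (nabla T T) (\<lambda>c x. 0)"
    then show "critical X A Or (orthogonal_field g T) T"
      by (intro contract_zero_imp_critical geodesic_contract_zero) auto
    from * show "gv X A Or (orthogonal_field g T) T = 0"
      by (intro contract_zero_imp_gv_zero geodesic_contract_zero) auto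
  next
    fix g F T
    assume *: "riemannian_metric A g \<and> transversely_oriented_foliation X A F \<and>
      bundle_like g F \<and> unit_normal A g F T"
    then interpret foliated_atlas X A F
      by unfold_locales simp
    show "critical X A Or (tangent_field F) T"
      by (rule contract_zero_imp_critical) (use * foliation_ext_deriv_zero[of g T] in \<open>simp add: contract_def\<close>)
  qed
qed

end
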